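(* For a prime $p$ let $\ell_2(p)=\lceil\log_2p\rceil$ and let the power-of-2 set be $A_{2,p}=\{0,\pm1,\pm2,\dots,\pm2^{\ell_2(p)-1}\}\subset\mathbb{Z}/p\mathbb{Z}$. Set $$c_0=\sum_{j=1}^\infty\left(1-\cos\frac{2\pi}{2^j}\right)=3.394649802\ldots.$$ The power-of-2 walk $(\mathbb{Z}/p\mathbb{Z},\mu_{A_{2,p}},\mathbb{U}_{\mathbb{Z}/p\mathbb{Z}})_{p\text{ prime}}$ has cut-off in total variation, at mixing time $$t_1^{\mathrm{mix}}(p)\sim\frac{\ell_2(p)\log\ell_2(p)}{2c_0}\qquad(p\to\infty).$$
   Context: $\log_2$ is the logarithm base $2$ and $\log$ the natural logarithm. $\mu_A$ is the uniform probability measure on $A\subset\mathbb{Z}/p\mathbb{Z}$, $\mu_A^{*n}$ its $n$-fold convolution power (law of the walk at step $n$ started from $0$), and $\mathbb{U}_{\mathbb{Z}/p\mathbb{Z}}$ is the uniform measure. $\|\mu-\nu\|_{\mathrm{TV}}=\sup_S|\mu(S)-\nu(S)|$; $t_1^{\mathrm{mix}}(\epsilon)=\inf\{n:\|\mu_A^{*n}-\mathbb{U}\|_{\mathrm{TV}}\le\epsilon\}$, $t_1^{\mathrm{mix}}=t_1^{\mathrm{mix}}(1/e)$. A sequence of walks has cut-off in total variation if for all $0<\epsilon<\frac12$ the ratio $t_1^{\mathrm{mix}}(\epsilon)/t_1^{\mathrm{mix}}(1-\epsilon)$ tends to $1$ along the sequence. $A\sim B$ means $A/B\to1$. *)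

theory Defs
  imports
    "HOL-Probability.Probability"
    "HOL-Number_Theory.Residues"
    "HOL-Library.Landau_Symbols"
begin

text \<open>
  Random walks on the additive group of a ring structure; the group of integers modulo \<open>m\<close>
  is \<^const>\<open>residue_ring\<close>, with carrier \<open>{0..m - 1}\<close>.
\<close>

definition conv_pmf :: "('a, 'b) ring_scheme \<Rightarrow> 'a pmf \<Rightarrow> 'a pmf \<Rightarrow> 'a pmf" where
  "conv_pmf R \<mu> \<nu> = map_pmf (\<lambda>(x, y). x \<oplus>\<^bsub>R\<^esub> y) (pair_pmf \<mu> \<nu>)"

primrec conv_power :: "('a, 'b) ring_scheme \<Rightarrow> 'a pmf \<Rightarrow> nat \<Rightarrow> 'a pmf" where
  "conv_power R \<mu> 0 = return_pmf \<zero>\<^bsub>R\<^esub>"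
| "conv_power R \<mu> (Suc n) = conv_pmf R (conv_power R \<mu> n) \<mu>"

definition tv_dist :: "'a pmf \<Rightarrow> 'a pmf \<Rightarrow> real" where
  "tv_dist \<mu> \<nu> = (SUP S. \<bar>measure_pmf.prob \<mu> S - measure_pmf.prob \<nu> S\<bar>)"

text \<open>
  The infimum is taken in \<^typ>\<open>nat\<close>, where \<open>Inf {} = 0\<close>. This convention is irrelevant
  for the walks considered below: they are irreducible and aperiodic (their step set generates
  the group and contains 0), so the set is nonempty for every \<open>\<epsilon> > 0\<close>.
\<close>
definition mix_time :: "('a, 'b) ring_scheme \<Rightarrow> 'a set \<Rightarrow> real \<Rightarrow> nat" where
  "mix_time R A \<epsilon> =
     Inf {n. tv_dist (conv_power R (pmf_of_set A) n) (pmf_of_set (carrier R)) \<le> \<epsilon>}"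

text \<open>
  Cut-off for a family of walks on \<open>R i\<close> with step set \<open>A i\<close>, along a filter on the index type.
\<close>
definition has_tv_cutoff ::
    "('i \<Rightarrow> ('a, 'b) ring_scheme) \<Rightarrow> ('i \<Rightarrow> 'a set) \<Rightarrow> 'i filter \<Rightarrow> bool" where
  "has_tv_cutoff R A F \<longleftrightarrow>
     (\<forall>\<epsilon>::real. 0 < \<epsilon> \<and> \<epsilon> < 1 / 2 \<longrightarrow>
        ((\<lambda>i. real (mix_time (R i) (A i) \<epsilon>) / real (mix_time (R i) (A i) (1 - \<epsilon>)))
           \<longlongrightarrow> 1) F)"

text \<open>The filter of \<open>p \<rightarrow> \<infinity>\<close> along the primes.\<close>
definition primes_at_top :: "nat filter" where
  "primes_at_top = inf at_top (principal {p. prime p})"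

definition ell2 :: "nat \<Rightarrow> nat" where
  "ell2 p = nat \<lceil>log 2 (real p)\<rceil>"

definition power2_set :: "nat \<Rightarrow> int set" where
  "power2_set p =
     {0} \<union> (\<Union>i<ell2 p. {2 ^ i mod int p, (- (2 ^ i)) mod int p})"

text \<open>The series starts at \<open>j = 1\<close>, hence the shift.\<close>
definition c0 :: real where
  "c0 = (\<Sum>j. 1 - cos (2 * pi / 2 ^ Suc j))"

end

theory Submission
  imports Defs "HOL-Real_Asymp.Real_Asymp"
begin

text \<open>
  Write \<open>cost x = 1 - cos (2 \<pi> x)\<close>. If the step set is \<open>{0} \<union> {\<plusminus> 2^i | i < m}\<close> with \<open>2 m + 1\<close>
  distinct residues, the Fourier coefficient of one step at the frequency \<open>\<xi>\<close> is
  \<open>1 - 2 S(\<xi>) / (2 m + 1)\<close>, where \<open>S(\<xi>) = \<Sum>i<m. cost (2^i \<xi> / p)\<close> is the cost of the orbit of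
  \<open>\<xi> / p\<close> under doubling. After \<open>n\<close> steps the coefficient is about \<open>exp (- 2 n S(\<xi>) / (2 m + 1))\<close>.
  An orbit that starts near \<open>0\<close>, at \<open>\<xi> / p \<approx> 1 / 2^k\<close>, and returns to it pays
  \<open>\<Sum>j\<ge>1. cost (1 / 2^j) = c0\<close>, and there are about \<open>m\<close> choices of \<open>k\<close>. In the square of the
  \<open>L\<^sup>2\<close> distance such frequencies contribute about \<open>m exp (- 2 n c0 / m)\<close>, which is of order \<open>1\<close> at
  \<open>n = m ln m / (2 c0)\<close>. This is the cut-off time; it remains to see that nothing decays more slowly
  in total, and that before this time the walk is far from uniform also in total variation.

  \<^bold>\<open>Upper bound.\<close> By Plancherel it suffices that \<open>\<Sum>\<xi>\<noteq>0. exp (- \<beta> S(\<xi>))\<close> tends to \<open>0\<close> when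
  \<open>\<beta> = \<alpha> ln m\<close> with \<open>\<alpha> > 1 / c0\<close> (\<open>character_sum_small\<close>); Fourier coefficients close to \<open>-1\<close> do
  not occur. Folding the circle onto \<open>[0, 1/2]\<close> turns doubling into the tent map, and the sum over
  \<open>\<xi>\<close> becomes a sum over itineraries, which are words of length \<open>m\<close> in the two inverse branches.
  The sum over all words satisfies a transfer recursion with two terms. One of them, the branch towards
  \<open>0\<close>, only accumulates the cost of a descent to \<open>0\<close>; the other one starts a new excursion and costs
  \<open>c0\<close> up to a small error if it starts near \<open>0\<close>. An explicit supersolution (\<open>partition_sum_le\<close>)
  shows that, relative to it, each step multiplies the sum by at most \<open>1 + exp (- \<beta> (c0 - \<gamma>))\<close> with
  \<open>\<gamma>\<close> small, apart from a bounded number of steps with a weaker bound that also tends to \<open>1\<close>. The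
  product of all these factors tends to \<open>1\<close>, because \<open>m exp (- \<beta> (c0 - \<gamma>))\<close> tends to \<open>0\<close>; the itinerary of the frequency
  \<open>0\<close> alone accounts for this \<open>1\<close>.

  \<^bold>\<open>Lower bound.\<close> The walk is lifted to a walk \<open>Y\<close> on the integers. For a sparse set of indices \<open>k\<close> the
  sum of the characters \<open>exp (2 \<pi> i Y / 2^k)\<close> is concentrated around a large mean, since two such
  characters are almost uncorrelated when the indices are far apart (\<open>sum_cost_dyadic_diff\<close>); for a
  uniform integer in an interval of length \<open>p\<close> the same sum is small. Only \<open>Y mod p\<close> is observed, but
  \<open>Y div p\<close> takes few values with high probability, so a union bound over these values suffices
  (\<open>tv_lower_bound\<close>). Working on the integers avoids the boundary effect of replacing \<open>p / 2^k\<close>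
  by an integer frequency, which changes the cost by an amount that depends on the binary digits of
  \<open>p\<close> and is not negligible.

  The step set has \<open>2 m + 1\<close> elements with \<open>m = ell2 p\<close>, except if \<open>p\<close> is a Fermat prime, where
  \<open>2^(ell2 p - 1) = -1\<close> and \<open>m = ell2 p - 1\<close> (\<open>power2_set_dyadic\<close>); the asymptotics are the same.
\<close>

section \<open>The cost of a doubling orbit\<close>

definition cost :: "real \<Rightarrow> real" where
  "cost x = 1 - cos (2 * pi * x)"

text \<open>
  The cost of halving \<open>k\<close> times: the orbit segment from \<open>t / 2^k\<close> up to \<open>t\<close> under doubling, without
  the end point \<open>t\<close>. For \<open>t = 1\<close> and \<open>k \<rightarrow> \<infinity>\<close> it is the cost \<open>c0\<close> of a complete excursion from \<open>0\<close>.
\<close>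
definition descent_cost :: "nat \<Rightarrow> real \<Rightarrow> real" where
  "descent_cost k t = (\<Sum>j<k. cost (t / 2 ^ Suc j))"

lemma cost_nonneg [simp]: "0 \<le> cost x"
  by (simp add: cost_def)

lemma cost_minus [simp]: "cost (- x) = cost x"
  by (simp add: cost_def)

lemma cost_add_int [simp]: "cost (x + of_int z) = cost x"
proof -
  have "cos (2 * pi * (x + of_int z)) = cos (2 * pi * x + 2 * pi * of_int z)"
    by (simp add: algebra_simps)
  also have "\<dots> = cos (2 * pi * x)"
    using cos_int_2pin[of z] sin_int_2pin[of z] by (simp add: cos_add mult.assoc)
  finally show ?thesis by (simp add: cost_def)
qed

lemma cost_int [simp]: "cost (of_int z) = 0"
  using cost_add_int[of 0 z] by (simp add: cost_def)

lemma abs_cos_diff_le: "\<bar>cos x - cos y\<bar> \<le> \<bar>x - y\<bar>" for x y :: real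
proof -
  have "\<bar>cos x - cos y\<bar> = 2 * \<bar>sin ((x + y) / 2)\<bar> * \<bar>sin ((y - x) / 2)\<bar>"
    by (simp add: cos_diff_cos abs_mult)
  also have "\<dots> \<le> 2 * 1 * \<bar>(y - x) / 2\<bar>"
    by (intro mult_mono abs_sin_x_le_abs_x) auto
  also have "\<dots> = \<bar>x - y\<bar>" by simp
  finally show ?thesis .
qed

lemma cost_lipschitz: "\<bar>cost x - cost y\<bar> \<le> 2 * pi * \<bar>x - y\<bar>"
proof -
  have "\<bar>cost x - cost y\<bar> = \<bar>cos (2 * pi * y) - cos (2 * pi * x)\<bar>"
    by (simp add: cost_def)
  also have "\<dots> \<le> \<bar>2 * pi * y - 2 * pi * x\<bar>" by (rule abs_cos_diff_le)
  also have "\<dots> = 2 * pi * \<bar>x - y\<bar>"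
    by (simp add: abs_mult abs_minus_commute flip: right_diff_distrib)
  finally show ?thesis .
qed

lemma cost_le: "cost x \<le> 2 * pi * \<bar>x\<bar>"
  using cost_lipschitz[of x 0] cost_nonneg[of x] by (simp add: cost_def)

lemma cost_mono: "0 \<le> x \<Longrightarrow> x \<le> y \<Longrightarrow> y \<le> 1/2 \<Longrightarrow> cost x \<le> cost y"
  unfolding cost_def using cos_monotone_0_pi_le[of "2 * pi * x" "2 * pi * y"]
  by (simp add: mult_left_mono)

lemma descent_cost_0 [simp]: "descent_cost 0 t = 0"
  by (simp add: descent_cost_def)

lemma descent_cost_Suc: "descent_cost (Suc k) t = cost (t / 2) + descent_cost k (t / 2)"
  unfolding descent_cost_def by (subst sum.lessThan_Suc_shift) (simp add: field_simps)

lemma descent_cost_nonneg: "0 \<le> descent_cost k t"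
  unfolding descent_cost_def by (intro sum_nonneg) simp

lemma descent_cost_mono_steps: "j \<le> k \<Longrightarrow> descent_cost j t \<le> descent_cost k t"
  unfolding descent_cost_def by (intro sum_mono2) auto

lemma descent_cost_mono:
  assumes "0 \<le> s" "s \<le> t" "t \<le> 1"
  shows "descent_cost k s \<le> descent_cost k t"
  unfolding descent_cost_def
proof (intro sum_mono cost_mono)
  fix j
  show "0 \<le> s / 2 ^ Suc j" using assms by simp
  show "s / 2 ^ Suc j \<le> t / 2 ^ Suc j" using assms by (simp add: divide_right_mono)
  have "t / 2 ^ Suc j \<le> 1 / 2 ^ Suc j" using assms by (intro divide_right_mono) auto
  also have "\<dots> \<le> 1 / 2" by (simp add: field_simps)
  finally show "t / 2 ^ Suc j \<le> 1 / 2" .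
qed

lemma descent_cost_lipschitz: "\<bar>descent_cost k s - descent_cost k t\<bar> \<le> 2 * pi * \<bar>s - t\<bar>"
proof (induction k arbitrary: s t)
  case (Suc k)
  have "\<bar>descent_cost (Suc k) s - descent_cost (Suc k) t\<bar>
      \<le> \<bar>cost (s/2) - cost (t/2)\<bar> + \<bar>descent_cost k (s/2) - descent_cost k (t/2)\<bar>"
    by (simp add: descent_cost_Suc)
  also have "\<dots> \<le> 2 * pi * \<bar>s/2 - t/2\<bar> + 2 * pi * \<bar>s/2 - t/2\<bar>"
    by (intro add_mono cost_lipschitz Suc.IH)
  also have "\<dots> = 2 * pi * \<bar>s - t\<bar>" by (simp flip: diff_divide_distrib)
  finally show ?case .
qed simp

lemma c0_summable: "summable (\<lambda>j. cost (1 / 2 ^ Suc j))"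
proof (rule summable_comparison_test')
  show "summable (\<lambda>j. pi * (1 / 2) ^ j)" by (intro summable_mult summable_geometric) simp
  show "norm (cost (1 / 2 ^ Suc j)) \<le> pi * (1 / 2) ^ j" for j
    using cost_le[of "1 / 2 ^ Suc j"] by (simp add: field_simps)
qed

lemma c0_eq: "c0 = (\<Sum>j. cost (1 / 2 ^ Suc j))"
  by (simp add: c0_def cost_def)

lemma descent_cost_1_tendsto: "(\<lambda>k. descent_cost k 1) \<longlonglongrightarrow> c0"
  unfolding descent_cost_def c0_eq by (rule summable_LIMSEQ[OF c0_summable])

lemma descent_cost_1_le: "descent_cost k 1 \<le> c0"
  unfolding descent_cost_def c0_eq by (rule sum_le_suminf[OF c0_summable]) auto

text \<open>
  The missing tail is the cost of a descent from \<open>1 / 2^k\<close>, which the Lipschitz bound controls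
  uniformly in its length.
\<close>
lemma c0_le_descent_cost_1: "c0 \<le> descent_cost k 1 + 2 * pi / 2 ^ k"
proof (rule LIMSEQ_le_const2[OF descent_cost_1_tendsto], intro exI allI impI)
  fix n assume "k \<le> n"
  then obtain r where n: "n = k + r" using le_Suc_ex by blast
  have "descent_cost (k + r) 1 = descent_cost k 1 + descent_cost r (1 / 2 ^ k)"
    unfolding descent_cost_def
  proof (induction r)
    case (Suc r)
    then show ?case by (simp add: power_add field_simps)
  qed simp
  also have "descent_cost r (1 / 2 ^ k) \<le> 2 * pi / 2 ^ k"
    using descent_cost_lipschitz[of r "1 / 2 ^ k" 0] by (simp add: descent_cost_def cost_def)
  finally show "descent_cost n 1 \<le> descent_cost k 1 + 2 * pi / 2 ^ k" by (simp add: n)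
qed

lemma descent_cost_1_ge_2: "2 \<le> descent_cost (Suc k) 1"
  using descent_cost_mono_steps[of 1 "Suc k" 1]
  by (simp add: descent_cost_Suc[of 0, simplified] cost_def)

lemma c0_ge_2: "2 \<le> c0"
  using descent_cost_1_ge_2[of 0] descent_cost_1_le[of "Suc 0"] by linarith

text \<open>
  The first halving already separates the two descents; all later ones are ordered by monotonicity.
  This gap between the two preimages \<open>t / 2\<close> and \<open>(1 - t) / 2\<close> is what makes the branch towards \<open>0\<close>
  the dominant one.
\<close>
lemma descent_cost_reflect:
  assumes "0 \<le> t" "t \<le> 1/2"
  shows "descent_cost (Suc k) t + 2 * cos (pi * t) \<le> descent_cost (Suc k) (1 - t)"
proof -
  have "cos (pi * (1 - t)) = - cos (pi * t)"
    by (simp add: right_diff_distrib cos_diff)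
  hence "cost ((1 - t) / 2) = cost (t / 2) + 2 * cos (pi * t)"
    by (simp add: cost_def)
  moreover have "descent_cost k (t / 2) \<le> descent_cost k ((1 - t) / 2)"
    using assms by (intro descent_cost_mono) auto
  ultimately show ?thesis by (simp add: descent_cost_Suc)
qed

lemma sin_half_pi_ge:
  fixes t :: real
  assumes "0 \<le> t" "t \<le> 1"
  shows "t \<le> sin (pi * t / 2)"
proof -
  have "concave_on {0..pi/2} sin"
    unfolding concave_on_def
    by (rule f''_ge0_imp_convex[where f' = "\<lambda>x. - cos x" and f'' = sin])
      (auto intro!: derivative_eq_intros sin_ge_zero)
  from concave_onD[OF this, of t 0 "pi/2"] assms show ?thesis by (simp add: field_simps)
qed

lemma descent_cost_ge_square:
  assumes "0 \<le> t" "t \<le> 1/2"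
  shows "2 * t\<^sup>2 \<le> descent_cost (Suc k) t"
proof -
  have "t \<le> sin (pi * t / 2)" using assms by (intro sin_half_pi_ge) auto
  hence "t\<^sup>2 \<le> (sin (pi * t / 2))\<^sup>2" using assms by (intro power_mono) auto
  also have "2 * (sin (pi * t / 2))\<^sup>2 = cost (t / 2)"
    using cos_double_sin[of "pi * t / 2"] by (simp add: cost_def field_simps)
  finally have "2 * t\<^sup>2 \<le> cost (t/2)" by simp
  thus ?thesis using descent_cost_nonneg[of k "t/2"] by (simp add: descent_cost_Suc)
qed

section \<open>The value of the constant\<close>

text \<open>
  The half-angle formula. It determines \<open>cost (x / 2)\<close> from \<open>cost x\<close> by one square root, so that the
  values \<open>cost (1 / 2^j)\<close> can be enclosed in rational intervals without any approximation of \<open>\<pi>\<close>.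
\<close>
lemma cost_half_angle: "(1 - cost (x / 2))\<^sup>2 = 1 - cost x / 2"
  using cos_double_cos[of "pi * x"] by (simp add: cost_def field_simps)

lemma cost_half_le_1: "\<bar>x\<bar> \<le> 1/2 \<Longrightarrow> cost (x / 2) \<le> 1"
proof -
  assume "\<bar>x\<bar> \<le> 1/2"
  hence "\<bar>pi * x\<bar> \<le> pi * (1/2)" unfolding abs_mult by (intro mult_mono) auto
  hence "- (pi / 2) \<le> pi * x" "pi * x \<le> pi / 2" by linarith+
  hence "0 \<le> cos (pi * x)" by (rule cos_ge_zero)
  thus ?thesis by (simp add: cost_def)
qed

lemma cost_half_enclosure:
  assumes "l \<le> cost x" "cost x \<le> u" "\<bar>x\<bar> \<le> 1/2"
    and "1 - l / 2 \<le> (1 - l')\<^sup>2" "l' \<le> 1" "(1 - u')\<^sup>2 \<le> 1 - u / 2"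
  shows "l' \<le> cost (x / 2)" "cost (x / 2) \<le> u'"
proof -
  have le1: "cost (x / 2) \<le> 1" using assms(3) by (rule cost_half_le_1)
  have "(1 - cost (x / 2))\<^sup>2 \<le> (1 - l')\<^sup>2"
    using assms(1,4) unfolding cost_half_angle by linarith
  hence "1 - cost (x / 2) \<le> 1 - l'" by (rule power2_le_imp_le) (use assms in simp)
  thus "l' \<le> cost (x / 2)" by simp
  have "(1 - u')\<^sup>2 \<le> (1 - cost (x / 2))\<^sup>2"
    using assms(2,6) unfolding cost_half_angle by linarith
  hence "1 - u' \<le> 1 - cost (x / 2)" by (rule power2_le_imp_le) (use le1 in simp)
  thus "cost (x / 2) \<le> u'" by simp
qed

lemma cost_half_ge_quarter: "cost x / 4 \<le> cost (x / 2)"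
proof -
  have "(1 - cost (x / 2))\<^sup>2 = 1 - 2 * cost (x / 2) + (cost (x / 2))\<^sup>2"
    by (simp add: power2_diff)
  thus ?thesis
    using cost_half_angle[of x] zero_le_power2[of "cost (x/2)"] by linarith
qed

lemma cost_half_le_quarter:
  assumes "\<bar>x\<bar> \<le> 1/2" "cost x \<le> 1 / 10^5"
  shows "cost (x / 2) \<le> 250001 / 10^6 * cost x"
proof (rule cost_half_enclosure(2)[OF order_refl order_refl assms(1)])
  have "cost x * cost x \<le> 1 / 10^5 * cost x" using assms(2) by (intro mult_right_mono) auto
  moreover have "(1 - 250001 / 10 ^ 6 * cost x)\<^sup>2
      = 1 - 2 * 250001 / 10^6 * cost x + (250001 / 10^6)\<^sup>2 * (cost x * cost x)"
    by (simp add: power2_eq_square algebra_simps)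
  moreover have "(250001 / 10^6)\<^sup>2 * (cost x * cost x) \<le> 1/10 * (cost x * cost x)"
    by (intro mult_right_mono) (auto simp: power2_eq_square)
  moreover have "1/10 * (1 / 10^5 * cost x) \<le> 2 * 250001 / 10^6 * cost x - cost x / 2"
    using cost_nonneg[of x] by simp
  ultimately show "(1 - 250001 / 10 ^ 6 * cost x)\<^sup>2 \<le> 1 - cost x / 2"
    by linarith
  show "1 - cost x / 2 \<le> (1 - cost (x/2))\<^sup>2" by (simp add: cost_half_angle)
qed (use cost_half_le_1[OF assms(1)] in simp)

text \<open>
  Eleven terms are enclosed one after the other by the half-angle formula. The remaining ones shrink by
  a factor between \<open>1/4\<close> and \<open>0.250001\<close> in each step, and so the tail lies between two geometric
  series. Eleven terms are needed because \<open>c0 = 3.3946498021...\<close> exceeds the lower bound by \<open>1.3e-10\<close>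
  only.
\<close>
lemma c0_numeric: "3.394649802 \<le> c0 \<and> c0 < 3.394649803"
proof -
  define d where "d j = cost (1 / 2 ^ Suc j)" for j
  have half: "\<bar>1 / 2 ^ Suc j\<bar> \<le> (1/2 :: real)" for j
  proof -
    have "1 / 2 ^ Suc j \<le> (1 / 2 ^ 1 :: real)" by (intro divide_left_mono power_increasing) auto
    thus ?thesis by simp
  qed
  have dS: "d (Suc j) = cost (1 / 2 ^ Suc j / 2)" for j by (simp add: d_def field_simps)
  have step: "l' \<le> d (Suc j) \<and> d (Suc j) \<le> u'"
    if "l \<le> d j \<and> d j \<le> u" "1 - l / 2 \<le> (1 - l')\<^sup>2" "l' \<le> 1" "(1 - u')\<^sup>2 \<le> 1 - u / 2" for j l u l' u'
    unfolding dS using cost_half_enclosure[of l "1 / 2 ^ Suc j" u l' u'] that half[of j]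
    unfolding d_def by blast
  have d0: "d 0 = 2" by (simp add: d_def cost_def)
  have d1: "1 \<le> d 1 \<and> d 1 \<le> 1" using cos_pi_half by (simp add: d_def cost_def)
  have d2: "0.29289321881345 \<le> d 2 \<and> d 2 \<le> 0.29289321881346"
    using step[of 1 1 1 "0.29289321881345" "0.29289321881346"] d1 by (simp add: power2_eq_square numeral_2_eq_2[symmetric])
  have d3: "0.07612046748871 \<le> d 3 \<and> d 3 \<le> 0.07612046748872"
    using step[OF d2, of "0.07612046748871" "0.07612046748872"] by (simp add: power2_eq_square)
  have d4: "0.01921471959676 \<le> d 4 \<and> d 4 \<le> 0.01921471959678"
    using step[OF d3, of "0.01921471959676" "0.01921471959678"] by (simp add: power2_eq_square)
  have d5: "0.00481527332780 \<le> d 5 \<and> d 5 \<le> 0.00481527332781"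
    using step[OF d4, of "0.00481527332780" "0.00481527332781"] by (simp add: power2_eq_square)
  have d6: "0.00120454379482 \<le> d 6 \<and> d 6 \<le> 0.00120454379483"
    using step[OF d5, of "0.00120454379482" "0.00120454379483"] by (simp add: power2_eq_square)
  have d7: "0.00030118130379 \<le> d 7 \<and> d 7 \<le> 0.00030118130380"
    using step[OF d6, of "0.00030118130379" "0.00030118130380"] by (simp add: power2_eq_square)
  have d8: "0.00007529816085 \<le> d 8 \<and> d 8 \<le> 0.00007529816086"
    using step[OF d7, of "0.00007529816085" "0.00007529816086"] by (simp add: power2_eq_square)
  have d9: "0.00001882471739 \<le> d 9 \<and> d 9 \<le> 0.00001882471740"
    using step[OF d8, of "0.00001882471739" "0.00001882471740"] by (simp add: power2_eq_square)
  have d10: "0.00000470619042 \<le> d 10 \<and> d 10 \<le> 0.00000470619043"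
    using step[OF d9, of "0.00000470619042" "0.00000470619043"] by (simp add: power2_eq_square)
  define T where "T = (\<Sum>j. d (j + 11))"
  have summ: "summable (\<lambda>j. d (j + 11))"
    unfolding d_def using c0_summable by (rule summable_ignore_initial_segment)
  have c0: "c0 = T + (\<Sum>j<11. d j)"
    unfolding T_def c0_eq d_def using c0_summable by (intro suminf_split_initial_segment) 
  have lo: "d 10 * (1/4) ^ Suc j \<le> d (j + 11)" for j
  proof (induction j)
    case 0
    show ?case using cost_half_ge_quarter[of "1 / 2 ^ Suc 10"] dS[of 10] by (simp add: d_def)
  next
    case (Suc j)
    show ?case using Suc.IH cost_half_ge_quarter[of "1 / 2 ^ Suc (j + 11)"] dS[of "j + 11"] by (simp add: d_def)
  qed
  have hi: "d (j + 11) \<le> d 10 * (250001/10^6) ^ Suc j \<and> d (j + 11) \<le> 1/10^5" for j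
  proof (induction j)
    case 0
    show ?case using cost_half_le_quarter[OF half[of 10]] dS[of 10] d10 by (simp add: d_def)
  next
    case (Suc j)
    show ?case using Suc.IH cost_half_le_quarter[OF half[of "j + 11"]] dS[of "j + 11"] by (simp add: d_def)
  qed
  have geo: "(\<lambda>j. d 10 * q ^ Suc j) sums (d 10 * (q / (1 - q)))" if "0 \<le> q" "q < 1" for q :: real
    using sums_mult[OF geometric_sums[of q], of "d 10 * q"] that by (simp add: mult_ac)
  have "d 10 * ((1/4) / (1 - 1/4)) \<le> T"
    unfolding T_def by (rule sums_le[OF lo geo summable_sums[OF summ]]) auto
  hence T1: "d 10 / 3 \<le> T" by simp
  have "T \<le> d 10 * ((250001/10^6) / (1 - 250001/10^6))"
    unfolding T_def by (rule sums_le[OF _ summable_sums[OF summ] geo]) (use hi in auto)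
  hence T2: "T \<le> d 10 * (250001 / 749999)" by simp
  have S: "(\<Sum>j<11. d j) = d 0 + d 1 + d 2 + d 3 + d 4 + d 5 + d 6 + d 7 + d 8 + d 9 + d 10"
    by (simp add: eval_nat_numeral)
  note facts = T1 T2 d0 d1 d2 d3 d4 d5 d6 d7 d8 d9 d10
  have "3.394649802 \<le> c0" unfolding c0 S using facts by simp
  moreover have "c0 < 3.394649803" unfolding c0 S using facts by simp
  ultimately show ?thesis ..
qed

section \<open>Itineraries of the doubling map\<close>

text \<open>
  The two inverse branches of the tent map on \<open>[0, 1/2]\<close>, that is, of doubling on the circle when
  \<open>x\<close> and \<open>- x\<close> are identified.
\<close>
definition branch :: "bool \<Rightarrow> real \<Rightarrow> real" where
  "branch b y = (if b then (1 - y) / 2 else y / 2)"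

text \<open>
  A word lists the branches from the end of an orbit segment back to its start: the orbit ends at \<open>y\<close>
  and begins at \<open>path_start w y\<close>. The cost of the end point itself is not counted, so that segments
  can be concatenated.
\<close>
primrec path_start :: "bool list \<Rightarrow> real \<Rightarrow> real" where
  "path_start [] y = y"
| "path_start (b # w) y = path_start w (branch b y)"

primrec path_cost :: "bool list \<Rightarrow> real \<Rightarrow> real" where
  "path_cost [] y = 0"
| "path_cost (b # w) y = cost (branch b y) + path_cost w (branch b y)"

definition partition_sum :: "real \<Rightarrow> nat \<Rightarrow> real \<Rightarrow> real" where
  "partition_sum \<beta> k y = (\<Sum>w\<in>{w. length w = k}. exp (- \<beta> * path_cost w y))"

lemma finite_words [simp]: "finite {w :: bool list. length w = k}"
  using finite_lists_length_eq[of "UNIV :: bool set" k] by simp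

lemma abs_branch_diff: "\<bar>branch b y - branch b y'\<bar> = \<bar>y - y'\<bar> / 2"
  by (auto simp: branch_def abs_minus_commute simp flip: diff_divide_distrib)

lemma abs_path_start_diff: "\<bar>path_start w y - path_start w y'\<bar> = \<bar>y - y'\<bar> / 2 ^ length w"
  by (induction w arbitrary: y y') (simp_all add: abs_branch_diff)

text \<open>
  Both branches contract by \<open>1/2\<close>, so the distances along the two orbits form a geometric series with
  sum \<open>\<bar>y - y'\<bar>\<close>, uniformly in the length of the word.
\<close>
lemma path_cost_lipschitz: "\<bar>path_cost w y - path_cost w y'\<bar> \<le> 2 * pi * \<bar>y - y'\<bar>"
proof (induction w arbitrary: y y')
  case (Cons b w)
  have "\<bar>path_cost (b # w) y - path_cost (b # w) y'\<bar>
      \<le> \<bar>cost (branch b y) - cost (branch b y')\<bar>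
        + \<bar>path_cost w (branch b y) - path_cost w (branch b y')\<bar>" by simp
  also have "\<dots> \<le> 2 * pi * \<bar>branch b y - branch b y'\<bar> + 2 * pi * \<bar>branch b y - branch b y'\<bar>"
    by (intro add_mono cost_lipschitz Cons.IH)
  also have "\<dots> = 2 * pi * \<bar>y - y'\<bar>" by (simp add: abs_branch_diff)
  finally show ?case .
qed simp

lemma path_cost_replicate_False [simp]: "path_cost (replicate k False) 0 = 0"
  by (induction k) (auto simp: branch_def cost_def)

lemma path_start_replicate_False [simp]: "path_start (replicate k False) y = y / 2 ^ k"
  by (induction k arbitrary: y) (auto simp: branch_def)

lemma partition_sum_0 [simp]: "partition_sum \<beta> 0 y = 1"
  by (simp add: partition_sum_def)

lemma partition_sum_Suc:
  "partition_sum \<beta> (Suc k) y =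
     exp (- \<beta> * cost (y / 2)) * partition_sum \<beta> k (y / 2)
     + exp (- \<beta> * cost ((1 - y) / 2)) * partition_sum \<beta> k ((1 - y) / 2)"
proof -
  let ?L = "{w :: bool list. length w = k}"
  have split: "{w :: bool list. length w = Suc k} = (#) False ` ?L \<union> (#) True ` ?L"
    by (auto simp: length_Suc_conv image_iff)
  have "partition_sum \<beta> (Suc k) y =
      (\<Sum>w\<in>(#) False ` ?L. exp (- \<beta> * path_cost w y)) + (\<Sum>w\<in>(#) True ` ?L. exp (- \<beta> * path_cost w y))"
    unfolding partition_sum_def split by (rule sum.union_disjoint) auto
  also have "\<dots> = (\<Sum>w\<in>?L. exp (- \<beta> * path_cost (False # w) y)) + (\<Sum>w\<in>?L. exp (- \<beta> * path_cost (True # w) y))"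
    by (simp add: sum.reindex)
  finally show ?thesis
    by (simp add: partition_sum_def branch_def sum_distrib_left algebra_simps flip: exp_add)
qed

text \<open>
  Every orbit segment of length \<open>k\<close> is recovered from its itinerary and its end point. The induction
  also has to carry that \<open>y\<close> agrees with \<open>2^k x\<close> up to sign and modulo \<open>1\<close>.
\<close>
lemma path_exists:
  fixes x :: real
  assumes "0 \<le> x" "x \<le> 1/2"
  shows "\<exists>w y. length w = k \<and> 0 \<le> y \<and> y \<le> 1/2 \<and> path_start w y = x
     \<and> path_cost w y = (\<Sum>i<k. cost (2 ^ i * x))"
proof -
  have "\<exists>w y. length w = k \<and> 0 \<le> y \<and> y \<le> 1/2 \<and> path_start w y = x
     \<and> path_cost w y = (\<Sum>i<k. cost (2 ^ i * x))
     \<and> (\<exists>z::int. y = 2 ^ k * x + of_int z \<or> y = - (2 ^ k * x) + of_int z)"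
  proof (induction k)
    case 0
    show ?case using assms by (intro exI[of _ "[]"] exI[of _ x]) auto
  next
    case (Suc k)
    then obtain w y z where w: "length w = k" "0 \<le> y" "y \<le> 1/2" "path_start w y = x"
      "path_cost w y = (\<Sum>i<k. cost (2 ^ i * x))"
      and z: "y = 2 ^ k * x + of_int z \<or> y = - (2 ^ k * x) + of_int z" by blast
    have cy: "cost y = cost (2 ^ k * x)"
      using z cost_add_int[of "2^k*x" z] cost_add_int[of "-(2^k*x)" z] by auto
    show ?case
    proof (cases "y \<le> 1/4")
      case True
      have b: "branch False (2 * y) = y" by (simp add: branch_def)
      have "\<exists>z'::int. 2 * y = 2 ^ Suc k * x + of_int z' \<or> 2 * y = - (2 ^ Suc k * x) + of_int z'"
        using z by (intro exI[of _ "2 * z"]) auto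
      thus ?thesis using w b cy True
        by (intro exI[of _ "False # w"] exI[of _ "2 * y"]) auto
    next
      case False
      have b: "branch True (1 - 2 * y) = y" by (simp add: branch_def)
      have "\<exists>z'::int. 1 - 2 * y = 2 ^ Suc k * x + of_int z' \<or> 1 - 2 * y = - (2 ^ Suc k * x) + of_int z'"
        using z by (intro exI[of _ "1 - 2 * z"]) auto
      thus ?thesis using w b cy False
        by (intro exI[of _ "True # w"] exI[of _ "1 - 2 * y"]) auto
    qed
  qed
  thus ?thesis by blast
qed

section \<open>A supersolution of the transfer recursion\<close>

text \<open>
  The number of halvings that bring \<open>t\<close> below the threshold \<open>3/8 / 2^r\<close> (\<open>level_0\<close>,
  \<open>level_half\<close>). The factor \<open>3/8\<close> keeps the jumps of this function away from \<open>1/2\<close> and from its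
  only preimage \<open>1/4\<close>, so that the level drops by one from points near \<open>1/2\<close> to both their preimages.
  There the cost alone gives no gain.
\<close>
definition level :: "nat \<Rightarrow> real \<Rightarrow> nat" where
  "level r t = card {j. j \<le> r \<and> 3 / 8 / 2 ^ j < t}"

lemma level_le: "level r t \<le> Suc r"
proof -
  have "level r t \<le> card {..r}" unfolding level_def by (intro card_mono) auto
  thus ?thesis by simp
qed

lemma level_le_of_le_threshold: "t \<le> 3/8 \<Longrightarrow> level r t \<le> r"
proof -
  assume "t \<le> 3/8"
  have "0 < j" if "3 / 8 / 2 ^ j < t" for j :: nat
    using that \<open>t \<le> 3/8\<close> by (cases j) auto
  hence "{j. j \<le> r \<and> 3 / 8 / 2 ^ j < t} \<subseteq> {1..r}"
    by (auto simp: Suc_le_eq)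
  hence "level r t \<le> card {1..r}" unfolding level_def by (intro card_mono) auto
  thus ?thesis by simp
qed

lemma level_0: "t \<le> 3 / 8 / 2 ^ r \<Longrightarrow> level r t = 0"
proof -
  assume t: "t \<le> 3 / 8 / 2 ^ r"
  have "{j. j \<le> r \<and> 3 / 8 / 2 ^ j < t} = {}"
  proof (safe, goal_cases)
    case (1 j)
    have "3 / 8 / 2 ^ r \<le> 3 / 8 / (2 ^ j :: real)"
      using 1 by (intro divide_left_mono power_increasing) auto
    with 1 t show ?case by linarith
  qed
  thus ?thesis unfolding level_def by (metis card.empty)
qed

lemma level_top: "3/8 < t \<Longrightarrow> level r t = Suc r"
proof -
  assume t: "3/8 < t"
  have "{j. j \<le> r \<and> 3 / 8 / 2 ^ j < t} = {..r}"
  proof -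
    have "3 / 8 / 2 ^ j < t" for j :: nat
    proof -
      have "3 / 8 / 2 ^ j \<le> 3 / 8 / (1::real)"
        by (intro divide_left_mono) auto
      with t show ?thesis by linarith
    qed
    thus ?thesis by auto
  qed
  thus ?thesis by (simp add: level_def)
qed

lemma level_half:
  assumes "3 / 8 / 2 ^ r < t" "t \<le> 1/2"
  shows "level r t = Suc (level r (t / 2))"
proof -
  have eq: "{j. j \<le> r \<and> 3 / 8 / 2 ^ j < t} = insert r {j. j < r \<and> 3 / 8 / 2 ^ j < t}"
    using assms by auto
  have "{j. j \<le> r \<and> 3 / 8 / 2 ^ j < t / 2} = Suc ` {j. j < r \<and> 3 / 8 / 2 ^ j < t}"
  proof (intro equalityI subsetI)
    fix j assume j: "j \<in> {j. j \<le> r \<and> 3 / 8 / 2 ^ j < t / 2}"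
    show "j \<in> Suc ` {j. j < r \<and> 3 / 8 / 2 ^ j < t}"
    proof (cases j)
      case 0
      with j assms show ?thesis by auto
    next
      case (Suc i)
      with j show ?thesis by (auto simp: image_iff field_simps)
    qed
  next
    fix j assume "j \<in> Suc ` {j. j < r \<and> 3 / 8 / 2 ^ j < t}"
    thus "j \<in> {j. j \<le> r \<and> 3 / 8 / 2 ^ j < t / 2}" by (auto simp: field_simps)
  qed
  hence "level r (t / 2) = card {j. j < r \<and> 3 / 8 / 2 ^ j < t}"
    by (simp add: level_def card_image)
  moreover have "level r t = Suc (card {j. j < r \<and> 3 / 8 / 2 ^ j < t})"
    unfolding level_def eq by (subst card_insert_disjoint) auto
  ultimately show ?thesis by simp
qed

text \<open>
  The function \<open>exp (- \<beta> (descent_cost k t - d level r t))\<close> is a supersolution of the recursion for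
  \<open>partition_sum\<close>. Below the threshold \<open>3/8 / 2^r\<close> the branch towards \<open>0\<close> reproduces it exactly, and
  the other branch adds an excursion of cost at least \<open>descent_cost (Suc j) 1 - \<gamma>\<close>. Above the threshold
  both branches gain a factor \<open>exp (- \<beta> d) \<le> 1/2\<close>, hence their sum is again bounded by the function.
  The small discount \<open>d\<close> per level pays for this gain; without it, at \<open>t = 1/2\<close> both preimages would
  reproduce the function and the sum would double.
\<close>
lemma partition_sum_le:
  fixes d \<beta> :: real
  assumes d: "0 < d" "d * (real r + 2) \<le> 7 / 10" and \<beta>: "ln 2 \<le> \<beta> * d"
    and t: "0 \<le> t" "t \<le> 1/2"
  defines "\<gamma> \<equiv> 4 * pi * (3 / 8 / 2 ^ r) + d * (real r + 1)"
  shows "partition_sum \<beta> k t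
       \<le> (\<Prod>j<k. 1 + exp (- \<beta> * (descent_cost (Suc j) 1 - \<gamma>)))
         * exp (- \<beta> * (descent_cost k t - d * level r t))"
  using t
proof (induction k arbitrary: t)
  case 0
  have "0 < \<beta> * d" using \<beta> ln_gt_zero[of "2::real"] by linarith
  hence "0 \<le> \<beta> * d * level r t" by simp
  thus ?case by (simp add: mult.assoc)
next
  case (Suc k)
  have "0 < \<beta> * d" using \<beta> ln_gt_zero[of "2::real"] by linarith
  hence pos: "0 < \<beta>" using d by (simp add: zero_less_mult_iff)
  define \<kappa> where "\<kappa> = exp (- \<beta> * (descent_cost (Suc k) 1 - \<gamma>))"
  define P where "P = (\<Prod>j<k. 1 + exp (- \<beta> * (descent_cost (Suc j) 1 - \<gamma>)))"
  define t' where "t' = (1 - t) / 2"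
  define A where "A = descent_cost (Suc k) t - d * level r (t / 2)"
  define B where "B = descent_cost (Suc k) (1 - t) - d * level r t'"
  define C where "C = descent_cost (Suc k) t - d * level r t"
  have P: "0 \<le> P" unfolding P_def by (intro prod_nonneg) (simp add: add_nonneg_nonneg)
  have le: "exp (- \<beta> * X) \<le> exp (- \<beta> * (D)) * exp (- \<beta> * C)" if "C + D \<le> X" for X D
  proof -
    have "\<beta> * (C + D) \<le> \<beta> * X" using that pos by simp
    thus ?thesis by (simp add: algebra_simps flip: exp_add)
  qed
  have half: "exp (- \<beta> * d) \<le> 1 / 2"
  proof -
    have "exp (- \<beta> * d) \<le> exp (- ln 2)" using \<beta> by (simp only: exp_le_cancel_iff)
    thus ?thesis by (simp add: exp_minus)
  qed
  have "exp (- \<beta> * A) + exp (- \<beta> * B) \<le> (1 + \<kappa>) * exp (- \<beta> * C)"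
  \<comment> \<open>Below the threshold the level vanishes and \<open>descent_cost\<close> is at most \<open>2 \<pi> t\<close>.\<close>
  proof (cases "t \<le> 3 / 8 / 2 ^ r")
    case True
    have l: "level r t = 0" using True by (rule level_0)
    have "t / 2 \<le> 3 / 8 / 2 ^ r" using True Suc.prems by linarith
    hence l2: "level r (t / 2) = 0" by (rule level_0)
    have "real (level r t') \<le> real r + 1" using level_le[of r t'] by simp
    hence n: "d * level r t' \<le> d * (real r + 1)" using d by (intro mult_left_mono) auto
    have f1: "descent_cost (Suc k) 1 - 2 * pi * t \<le> descent_cost (Suc k) (1 - t)"
      using descent_cost_lipschitz[of "Suc k" 1 "1 - t"] Suc.prems by simp
    have f2: "descent_cost (Suc k) t \<le> 2 * pi * t"
      using descent_cost_lipschitz[of "Suc k" t 0] Suc.prems by (simp add: descent_cost_def cost_def)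
    have "4 * pi * t \<le> 4 * pi * (3 / 8 / 2 ^ r)" using True by (intro mult_left_mono) auto
    hence "C + (descent_cost (Suc k) 1 - \<gamma>) \<le> B"
      unfolding B_def C_def \<gamma>_def using l n f1 f2 by simp
    from le[OF this] have "exp (- \<beta> * B) \<le> \<kappa> * exp (- \<beta> * C)" by (simp only: \<kappa>_def)
    moreover have "A = C" by (simp add: A_def C_def l l2)
    ultimately show ?thesis by (simp add: algebra_simps)
  next
    case False
    hence l: "level r t = Suc (level r (t / 2))" using Suc.prems by (intro level_half) auto
    have A: "C + d \<le> A" by (simp add: A_def C_def l algebra_simps)
    have B: "C + d \<le> B"
    \<comment> \<open>If \<open>t \<le> 3/8\<close>, the excursion is longer by \<open>2 cos (\<pi> t) \<ge> 7/10\<close>, which exceeds any change of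
      level. Otherwise the level of \<open>t\<close> is maximal and that of \<open>t' < 5/16\<close> is not.\<close>
    proof (cases "t \<le> 3 / 8")
      case True
      have "real (level r t') \<le> real r + 1" using level_le[of r t'] by simp
      hence n: "d * level r t' \<le> d * (real r + 1)" using d by (intro mult_left_mono) auto
      have "cos (pi * (3/8)) \<le> cos (pi * t)"
        using True Suc.prems by (intro cos_monotone_0_pi_le) auto
      moreover have "7/20 \<le> cos (pi * (3/8))"
      proof -
        have "cos (pi * (3/4)) = - sqrt 2 / 2"
          using cos_diff[of pi "pi/4"] by (simp add: cos_45 mult.commute)
        hence "2 * (cos (pi * (3/8)))\<^sup>2 = 1 - sqrt 2 / 2"
          using cos_double_cos[of "pi * (3/8)"] by (simp add: algebra_simps)
        moreover have "sqrt 2 \<le> 1.5" by (rule real_le_lsqrt) (auto simp: power2_eq_square)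
        ultimately have "(7/20)\<^sup>2 \<le> (cos (pi * (3/8)))\<^sup>2" by (simp add: power2_eq_square)
        moreover have "0 \<le> cos (pi * (3/8))" by (intro cos_ge_zero) auto
        ultimately show ?thesis by (rule power2_le_imp_le)
      qed
      ultimately have "7/10 \<le> 2 * cos (pi * t)" by linarith
      hence "descent_cost (Suc k) t + 7/10 \<le> descent_cost (Suc k) (1 - t)"
        using descent_cost_reflect[of t k] Suc.prems by linarith
      moreover have "0 \<le> d * level r t" using d by simp
      moreover have "d * (real r + 1) + d \<le> 7 / 10" using d by (simp add: algebra_simps)
      ultimately show ?thesis unfolding B_def C_def using n by linarith
    next
      case False
      hence "level r t = Suc r" by (intro level_top) auto
      moreover have "level r t' \<le> r" by (rule level_le_of_le_threshold) (use False in \<open>simp add: t'_def\<close>)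
      ultimately have "real (level r t') + 1 \<le> real (level r t)" by simp
      hence "d * (real (level r t') + 1) \<le> d * level r t" using d by (intro mult_left_mono) auto
      moreover have "descent_cost (Suc k) t \<le> descent_cost (Suc k) (1 - t)"
        using Suc.prems by (intro descent_cost_mono) auto
      ultimately show ?thesis unfolding B_def C_def by (simp add: algebra_simps)
    qed
    have "exp (- \<beta> * A) + exp (- \<beta> * B) \<le> 2 * (exp (- \<beta> * d) * exp (- \<beta> * C))"
      using le[OF A] le[OF B] by linarith
    also have "\<dots> \<le> 2 * (1 / 2 * exp (- \<beta> * C))"
      by (intro mult_left_mono mult_right_mono half) auto
    also have "\<dots> \<le> (1 + \<kappa>) * exp (- \<beta> * C)" by (simp add: \<kappa>_def algebra_simps)
    finally show ?thesis .
  qed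
  hence key: "P * (exp (- \<beta> * A) + exp (- \<beta> * B)) \<le> P * ((1 + \<kappa>) * exp (- \<beta> * C))"
    using P by (rule mult_left_mono)
  have "partition_sum \<beta> (Suc k) t
      \<le> exp (- \<beta> * cost (t / 2)) * (P * exp (- \<beta> * (descent_cost k (t / 2) - d * level r (t / 2))))
        + exp (- \<beta> * cost t') * (P * exp (- \<beta> * (descent_cost k t' - d * level r t')))"
    unfolding partition_sum_Suc P_def t'_def
    using Suc.prems by (intro add_mono mult_left_mono Suc.IH) auto
  also have "\<dots> = P * (exp (- \<beta> * A) + exp (- \<beta> * B))"
    unfolding A_def B_def descent_cost_Suc
    by (simp add: algebra_simps t'_def flip: exp_add)
  also note key
  finally show ?case by (simp add: P_def \<kappa>_def C_def mult.assoc)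
qed

section \<open>The sum over all frequencies\<close>

text \<open>
  Each frequency \<open>\<xi> \<le> (p - 1) / 2\<close> is determined by its itinerary of length \<open>m\<close>, because two orbits with
  the same itinerary start within \<open>1 / 2^(m + 1) < 1 / p\<close> of each other. The end point of the orbit
  depends on \<open>\<xi>\<close>; it is moved to \<open>0\<close> if it is at most \<open>y0\<close> and to the grid of mesh \<open>1 / H\<close> below it
  otherwise, at a price bounded by the Lipschitz constant. Then the sum over frequencies extends to all
  itineraries with a common end point. The word of the constant orbit \<open>0\<close> is not attained by
  \<open>\<xi> \<ge> 1\<close>, which gives the term \<open>-1\<close>.
\<close>
lemma character_sum_le:
  fixes p m H :: nat and \<beta> y0 :: real
  assumes p: "odd p" "p < 2 ^ Suc m" and \<beta>: "0 \<le> \<beta>" and y0: "0 < y0" "y0 \<le> 1/2" and H: "0 < H"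
  shows "(\<Sum>\<xi>=1..(p - 1) div 2. exp (- \<beta> * (\<Sum>i<m. cost (2 ^ i * (real \<xi> / real p)))))
    \<le> exp (2 * pi * \<beta> * y0) * (partition_sum \<beta> m 0 - 1)
      + (\<Sum>b | b \<le> H \<and> y0 - 1 / real H \<le> real b / real H \<and> real b / real H \<le> 1 / 2.
           exp (2 * pi * \<beta> / real H) * partition_sum \<beta> m (real b / real H))"
proof -
  define X where "X = {1..(p - 1) div 2}"
  define L where "L = {w :: bool list. length w = m}"
  define B where "B = {b. b \<le> H \<and> y0 - 1 / real H \<le> real b / real H \<and> real b / real H \<le> 1 / 2}"
  define S where "S \<xi> = (\<Sum>i<m. cost (2 ^ i * (real \<xi> / real p)))" for \<xi> :: nat
  have p0: "0 < p" using p by (auto intro: Nat.gr0I)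
  have "\<exists>w y. length w = m \<and> 0 \<le> y \<and> y \<le> 1/2 \<and> path_start w y = real \<xi> / real p \<and> path_cost w y = S \<xi>"
    if "\<xi> \<in> X" for \<xi>
  proof -
    have "2 * \<xi> \<le> p" using that by (auto simp: X_def)
    hence "real (2 * \<xi>) \<le> real p" by (simp only: of_nat_le_iff)
    hence "real \<xi> / real p \<le> 1/2" using p0 by (simp add: field_simps)
    thus ?thesis unfolding S_def by (intro path_exists) auto
  qed
  then obtain w y where wy: "\<And>\<xi>. \<xi> \<in> X \<Longrightarrow> length (w \<xi>) = m \<and> 0 \<le> y \<xi> \<and> y \<xi> \<le> 1/2
      \<and> path_start (w \<xi>) (y \<xi>) = real \<xi> / real p \<and> path_cost (w \<xi>) (y \<xi>) = S \<xi>"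
    by metis
  have pm: "real p < 2 * 2 ^ m" using p(2) by (metis of_nat_less_iff of_nat_numeral of_nat_power power_Suc)
  have inj: "inj_on w X"
  proof (rule inj_onI)
    fix \<xi> \<xi>' assume *: "\<xi> \<in> X" "\<xi>' \<in> X" "w \<xi> = w \<xi>'"
    have "\<bar>real \<xi> / real p - real \<xi>' / real p\<bar> = \<bar>y \<xi> - y \<xi>'\<bar> / 2 ^ m"
      using wy[OF *(1)] wy[OF *(2)] *(3) abs_path_start_diff[of "w \<xi>" "y \<xi>" "y \<xi>'"] by simp
    also have "\<dots> \<le> (1/2) / 2 ^ m"
    proof (rule divide_right_mono)
      show "\<bar>y \<xi> - y \<xi>'\<bar> \<le> 1/2" using wy[OF *(1)] wy[OF *(2)] by linarith
    qed simp
    finally have "\<bar>real \<xi> - real \<xi>'\<bar> / real p \<le> (1/2) / 2 ^ m"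
      by (simp flip: diff_divide_distrib)
    hence "\<bar>real \<xi> - real \<xi>'\<bar> \<le> real p * ((1/2) / 2 ^ m)" using p0 by (simp add: field_simps)
    also have "\<dots> < 1" using pm by (simp add: field_simps)
    finally have "\<bar>int \<xi> - int \<xi>'\<bar> < 1" by linarith
    thus "\<xi> = \<xi>'" by simp
  qed
  have cmp: "exp (- \<beta> * S \<xi>) \<le> exp (2 * pi * \<beta> * r) * exp (- \<beta> * path_cost (w \<xi>) c)"
    if "\<xi> \<in> X" "\<bar>y \<xi> - c\<bar> \<le> r" for \<xi> c r
  proof -
    have "\<bar>path_cost (w \<xi>) (y \<xi>) - path_cost (w \<xi>) c\<bar> \<le> 2 * pi * r"
      by (rule order_trans[OF path_cost_lipschitz]) (use that in simp)
    hence "path_cost (w \<xi>) c - 2 * pi * r \<le> S \<xi>" using wy[OF that(1)] by linarith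
    hence "\<beta> * (path_cost (w \<xi>) c - 2 * pi * r) \<le> \<beta> * S \<xi>" using \<beta> by (rule mult_left_mono)
    thus ?thesis by (simp add: algebra_simps flip: exp_add)
  qed
  have sub: "(\<Sum>\<xi>\<in>Y. exp (- \<beta> * path_cost (w \<xi>) c)) \<le> (\<Sum>v\<in>Z. exp (- \<beta> * path_cost v c))"
    if "Y \<subseteq> X" "w ` Y \<subseteq> Z" "finite Z" for Y Z c
  proof -
    have "(\<Sum>\<xi>\<in>Y. exp (- \<beta> * path_cost (w \<xi>) c)) = (\<Sum>v\<in>w ` Y. exp (- \<beta> * path_cost v c))"
      using inj that by (subst sum.reindex) (auto intro: inj_on_subset)
    also have "\<dots> \<le> (\<Sum>v\<in>Z. exp (- \<beta> * path_cost v c))"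
      using that by (intro sum_mono2) auto
    finally show ?thesis .
  qed
  define X1 where "X1 = {\<xi> \<in> X. y \<xi> \<le> y0}"
  define X2 where "X2 = {\<xi> \<in> X. \<not> y \<xi> \<le> y0}"
  have "(\<Sum>\<xi>\<in>X1. exp (- \<beta> * S \<xi>)) \<le> (\<Sum>\<xi>\<in>X1. exp (2 * pi * \<beta> * y0) * exp (- \<beta> * path_cost (w \<xi>) 0))"
    using wy by (intro sum_mono cmp) (auto simp: X1_def)
  also have "\<dots> = exp (2 * pi * \<beta> * y0) * (\<Sum>\<xi>\<in>X1. exp (- \<beta> * path_cost (w \<xi>) 0))"
    by (simp add: sum_distrib_left)
  also have "(\<Sum>\<xi>\<in>X1. exp (- \<beta> * path_cost (w \<xi>) 0)) \<le> (\<Sum>v\<in>L - {replicate m False}. exp (- \<beta> * path_cost v 0))"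
  proof (rule sub)
    have "w \<xi> \<noteq> replicate m False" if "\<xi> \<in> X1" for \<xi>
    proof
      assume "w \<xi> = replicate m False"
      hence "real \<xi> / real p = y \<xi> / 2 ^ m" using wy[of \<xi>] that by (auto simp: X1_def)
      also have "\<dots> \<le> (1/2) / 2 ^ m" using that y0 by (intro divide_right_mono) (auto simp: X1_def)
      finally have "real \<xi> \<le> real p * ((1/2) / 2 ^ m)" using p0 by (simp add: field_simps)
      also have "\<dots> < 1" using pm by (simp add: field_simps)
      finally show False using that by (simp add: X1_def X_def)
    qed
    thus "w ` X1 \<subseteq> L - {replicate m False}" using wy by (auto simp: X1_def L_def)
  qed (auto simp: X1_def L_def)
  also have "\<dots> = partition_sum \<beta> m 0 - 1"
    by (subst sum_diff1) (auto simp: partition_sum_def L_def)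
  finally have 1: "(\<Sum>\<xi>\<in>X1. exp (- \<beta> * S \<xi>)) \<le> exp (2 * pi * \<beta> * y0) * (partition_sum \<beta> m 0 - 1)"
    by simp
  define bf where "bf \<xi> = nat \<lfloor>y \<xi> * H\<rfloor>" for \<xi>
  have bf: "real (bf \<xi>) \<le> y \<xi> * H" "y \<xi> * H < real (bf \<xi>) + 1" if "\<xi> \<in> X" for \<xi>
    using wy[OF that] by (auto simp: bf_def)
  have bf': "real (bf \<xi>) / H \<le> y \<xi>" "y \<xi> - 1 / H \<le> real (bf \<xi>) / H" if "\<xi> \<in> X" for \<xi>
  proof -
    show "real (bf \<xi>) / H \<le> y \<xi>" using bf[OF that] H by (simp add: divide_le_eq)
    have "y \<xi> \<le> (real (bf \<xi>) + 1) / H" using bf[OF that] H by (simp add: le_divide_eq)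
    thus "y \<xi> - 1 / H \<le> real (bf \<xi>) / H" by (simp add: add_divide_distrib)
  qed
  have bB: "bf ` X2 \<subseteq> B"
  proof clarify
    fix \<xi> assume "\<xi> \<in> X2"
    hence x: "\<xi> \<in> X" "y0 \<le> y \<xi>" by (auto simp: X2_def)
    have h: "real (bf \<xi>) / H \<le> 1/2" using bf'[OF x(1)] wy[OF x(1)] by linarith
    hence "real (bf \<xi>) \<le> real H" using H by (simp add: field_simps)
    thus "bf \<xi> \<in> B" using bf'[OF x(1)] x(2) h by (auto simp: B_def)
  qed
  have finB: "finite B" by (rule finite_subset[of _ "{..H}"]) (auto simp: B_def)
  have "(\<Sum>\<xi>\<in>X2. exp (- \<beta> * S \<xi>)) = (\<Sum>b\<in>B. \<Sum>\<xi> | \<xi> \<in> X2 \<and> bf \<xi> = b. exp (- \<beta> * S \<xi>))"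
    by (rule sum.group[symmetric]) (use finB bB in \<open>auto simp: X2_def X_def\<close>)
  also have "\<dots> \<le> (\<Sum>b\<in>B. exp (2 * pi * \<beta> / real H) * partition_sum \<beta> m (real b / real H))"
  proof (rule sum_mono)
    fix b assume "b \<in> B"
    have "(\<Sum>\<xi> | \<xi> \<in> X2 \<and> bf \<xi> = b. exp (- \<beta> * S \<xi>))
        \<le> (\<Sum>\<xi> | \<xi> \<in> X2 \<and> bf \<xi> = b. exp (2 * pi * \<beta> * (1 / H)) * exp (- \<beta> * path_cost (w \<xi>) (real b / H)))"
    proof (intro sum_mono cmp)
      fix \<xi> assume x: "\<xi> \<in> {\<xi> \<in> X2. bf \<xi> = b}"
      thus "\<xi> \<in> X" by (simp add: X2_def)
      thus "\<bar>y \<xi> - real b / H\<bar> \<le> 1 / H" using bf'[of \<xi>] x by auto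
    qed
    also have "\<dots> = exp (2 * pi * \<beta> / H) * (\<Sum>\<xi> | \<xi> \<in> X2 \<and> bf \<xi> = b. exp (- \<beta> * path_cost (w \<xi>) (real b / H)))"
      by (simp add: sum_distrib_left)
    also have "(\<Sum>\<xi> | \<xi> \<in> X2 \<and> bf \<xi> = b. exp (- \<beta> * path_cost (w \<xi>) (real b / H))) \<le> partition_sum \<beta> m (real b / H)"
      unfolding partition_sum_def using wy by (intro sub) (auto simp: X2_def)
    finally show "(\<Sum>\<xi> | \<xi> \<in> X2 \<and> bf \<xi> = b. exp (- \<beta> * S \<xi>)) \<le> exp (2 * pi * \<beta> / real H) * partition_sum \<beta> m (real b / real H)"
      by simp
  qed
  finally have 2: "(\<Sum>\<xi>\<in>X2. exp (- \<beta> * S \<xi>)) \<le> (\<Sum>b\<in>B. exp (2 * pi * \<beta> / real H) * partition_sum \<beta> m (real b / real H))" .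
  have "(\<Sum>\<xi>\<in>X. exp (- \<beta> * S \<xi>)) = (\<Sum>\<xi>\<in>X1 \<union> X2. exp (- \<beta> * S \<xi>))"
    by (rule arg_cong[where f = "sum _"]) (auto simp: X1_def X2_def)
  also have "\<dots> = (\<Sum>\<xi>\<in>X1. exp (- \<beta> * S \<xi>)) + (\<Sum>\<xi>\<in>X2. exp (- \<beta> * S \<xi>))"
    by (rule sum.union_disjoint) (auto simp: X1_def X2_def X_def)
  finally show ?thesis using 1 2 by (simp add: X_def S_def B_def)
qed

lemma prod_one_plus_le_exp_sum:
  fixes f :: "nat \<Rightarrow> real"
  assumes "\<And>j. j < k \<Longrightarrow> 0 \<le> f j"
  shows "(\<Prod>j<k. 1 + f j) \<le> exp (\<Sum>j<k. f j)"
  unfolding exp_sum[OF finite_lessThan] using assms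
  by (intro prod_mono) (auto simp: add_nonneg_nonneg add.commute intro: exp_ge_add_one_self)

text \<open>
  With \<open>\<beta> = \<alpha> ln m\<close> all terms of \<open>character_sum_le\<close> are bounded by negative powers of \<open>m\<close>, provided that
  the parameters are fixed in a suitable order and independently of \<open>m\<close>. For orbits that end near
  \<open>0\<close> the relevant power is \<open>1 - \<alpha> (c0 - O(s))\<close>, the factor \<open>m\<close> being the number of times at which an
  excursion can begin; orbits that end away from \<open>0\<close> have to pay for their last, incomplete excursion,
  which can begin only boundedly often.
\<close>
lemma character_sum_small:
  fixes \<alpha> \<eta> :: real
  assumes \<alpha>: "1 / c0 < \<alpha>" and \<eta>: "0 < \<eta>"
  shows "\<forall>\<^sub>F m in at_top. \<forall>p::nat. odd p \<and> p < 2 ^ Suc m \<longrightarrow>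
    (\<Sum>\<xi>=1..(p - 1) div 2. exp (- (\<alpha> * ln m) * (\<Sum>i<m. cost (2 ^ i * (real \<xi> / real p))))) \<le> \<eta>"
proof -
  have c0: "2 \<le> c0" by (rule c0_ge_2)
  hence a0: "0 < \<alpha>" using \<alpha> by (meson divide_pos_pos le_less_trans less_le_trans less_numeral_extra(1) order.strict_trans zero_less_numeral)
  have ca: "1 < \<alpha> * c0" using \<alpha> c0 by (simp add: field_simps)
  \<comment> \<open>The margin: \<open>10 s\<close> leaves room for the losses \<open>2 s\<close> in the cost of an excursion and
    \<open>2 \<pi> s < 8 s\<close> in moving the end point.\<close>
  define s where "s = min (1/8) ((c0 - 1 / \<alpha>) / 10)"
  have s: "0 < s" "s \<le> 1/8" "10 * s \<le> c0 - 1 / \<alpha>"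
    using ca a0 by (auto simp: s_def field_simps min_def)
  have "(\<lambda>r. 4 * pi * (3 / 8 / 2 ^ r)) \<longlonglongrightarrow> 0" by real_asymp
  hence "\<forall>\<^sub>F r::nat in at_top. 4 * pi * (3 / 8 / 2 ^ r) < s / 2"
    using s by (intro order_tendstoD) auto
  then obtain r :: nat where r: "4 * pi * (3 / 8 / 2 ^ r) < s / 2"
    using eventually_happens trivial_limit_sequentially by blast
  \<comment> \<open>An orbit that ends at \<open>c \<ge> s / 2\<close> has paid at least \<open>2 c\<^sup>2 \<ge> s\<^sup>2 / 2\<close>; the discount and the grid
    may use up \<open>s\<^sup>2 / 8\<close> each.\<close>
  define d where "d = s\<^sup>2 / (8 * (real r + 2))"
  have "real r + 2 \<noteq> 0" by linarith
  hence dr: "d * (real r + 2) = s\<^sup>2 / 8" unfolding d_def by (simp add: divide_simps)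
  have ss: "s\<^sup>2 \<le> s * (1/4)" unfolding power2_eq_square using s by (intro mult_left_mono) auto
  have d: "0 < d" "d * (real r + 2) \<le> 7 / 10"
    unfolding dr using s ss by (auto simp: d_def)
  define \<gamma> where "\<gamma> = 4 * pi * (3 / 8 / 2 ^ r) + d * (real r + 1)"
  have drs: "d * (real r + 1) \<le> s\<^sup>2 / 8" using dr d by (simp add: algebra_simps)
  have \<gamma>: "\<gamma> \<le> s" unfolding \<gamma>_def using r drs ss s by linarith
  have "(\<lambda>k. 2 * pi / 2 ^ k) \<longlonglongrightarrow> 0" by real_asymp
  hence "\<forall>\<^sub>F k::nat in at_top. 2 * pi / 2 ^ k < s"
    using s by (intro order_tendstoD) auto
  then obtain k1 :: nat where k1: "2 * pi / 2 ^ k1 < s"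
    using eventually_happens trivial_limit_sequentially by blast
  have "(\<lambda>H. 2 * pi / real H) \<longlonglongrightarrow> 0" by real_asymp
  hence "\<forall>\<^sub>F H::nat in at_top. 2 * pi / real H < s\<^sup>2 / 8 \<and> 0 < H"
    using s by (intro eventually_conj order_tendstoD eventually_gt_at_top) auto
  then obtain H :: nat where H: "2 * pi / real H < s\<^sup>2 / 8" "0 < H"
    using eventually_happens trivial_limit_sequentially by blast
  have "1 / real H \<le> 2 * pi / real H" using pi_gt3 by (intro divide_right_mono) auto
  hence H2: "1 / real H \<le> s / 2" using H ss s by linarith
  define K where "K \<beta> m = real k1 * exp (- \<beta> * (2 - s)) + real m * exp (- \<beta> * (c0 - 2 * s))" for \<beta> :: real and m :: nat
  have bound: "(\<Sum>\<xi>=1..(p - 1) div 2. exp (- \<beta> * (\<Sum>i<m. cost (2 ^ i * (real \<xi> / real p)))))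
      \<le> 2 * (exp (2 * pi * \<beta> * s) * K \<beta> m) + real (Suc H) * 3 * exp (- \<beta> * (s\<^sup>2 / 4))"
    if p: "odd p" "p < 2 ^ Suc m" and \<beta>: "ln 2 \<le> \<beta> * d" and m: "0 < m"
      and K1: "exp (2 * pi * \<beta> * s) * K \<beta> m \<le> 1" for p m :: nat and \<beta> :: real
  proof -
    have "0 < \<beta> * d" using \<beta> ln_gt_zero[of "2::real"] by linarith
    hence pos: "0 < \<beta>" using d by (simp add: zero_less_mult_iff)
    define P where "P = (\<Prod>j<m. 1 + exp (- \<beta> * (descent_cost (Suc j) 1 - \<gamma>)))"
    have K0: "0 \<le> K \<beta> m" by (simp add: K_def)
    have "1 * K \<beta> m \<le> exp (2 * pi * \<beta> * s) * K \<beta> m"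
      using K0 pos s by (intro mult_right_mono) auto
    hence K2: "K \<beta> m \<le> 1" using K1 by linarith
    have "P \<le> exp (\<Sum>j<m. exp (- \<beta> * (descent_cost (Suc j) 1 - \<gamma>)))"
      unfolding P_def by (intro prod_one_plus_le_exp_sum) simp
    also have "(\<Sum>j<m. exp (- \<beta> * (descent_cost (Suc j) 1 - \<gamma>)))
        \<le> (\<Sum>j<m. (if j < k1 then exp (- \<beta> * (2 - s)) else 0) + exp (- \<beta> * (c0 - 2 * s)))"
    proof (rule sum_mono)
      fix j
      show "exp (- \<beta> * (descent_cost (Suc j) 1 - \<gamma>)) \<le> (if j < k1 then exp (- \<beta> * (2 - s)) else 0) + exp (- \<beta> * (c0 - 2 * s))"
      proof (cases "j < k1")
        case True
        have "2 - s \<le> descent_cost (Suc j) 1 - \<gamma>" using descent_cost_1_ge_2[of j] \<gamma> by linarith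
        hence "\<beta> * (2 - s) \<le> \<beta> * (descent_cost (Suc j) 1 - \<gamma>)" using pos by (intro mult_left_mono) auto
        hence "exp (- \<beta> * (descent_cost (Suc j) 1 - \<gamma>)) \<le> exp (- \<beta> * (2 - s))" by simp
        thus ?thesis unfolding if_P[OF True] using exp_gt_zero[of "- \<beta> * (c0 - 2 * s)"] by linarith
      next
        case False
        have "c0 \<le> descent_cost k1 1 + s" using c0_le_descent_cost_1[of k1] k1 by linarith
        also have "descent_cost k1 1 \<le> descent_cost (Suc j) 1"
          using False by (intro descent_cost_mono_steps) auto
        finally have "c0 - 2 * s \<le> descent_cost (Suc j) 1 - \<gamma>" using \<gamma> by linarith
        hence "\<beta> * (c0 - 2 * s) \<le> \<beta> * (descent_cost (Suc j) 1 - \<gamma>)" using pos by (intro mult_left_mono) auto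
        thus ?thesis using False by simp
      qed
    qed
    also have "\<dots> = real (card ({..<m} \<inter> {j. j < k1})) * exp (- \<beta> * (2 - s)) + real m * exp (- \<beta> * (c0 - 2 * s))"
      by (simp add: sum.distrib sum.If_cases)
    also have "\<dots> \<le> K \<beta> m"
    proof -
      have "card ({..<m} \<inter> {j. j < k1}) \<le> card {..<k1}" by (intro card_mono) auto
      thus ?thesis unfolding K_def by (intro add_right_mono mult_right_mono) auto
    qed
    finally have P: "P \<le> exp (K \<beta> m)" by simp
    have "exp (K \<beta> m) \<le> 1 + K \<beta> m + (K \<beta> m)\<^sup>2" using K0 K2 by (rule exp_bound)
    moreover have "(K \<beta> m)\<^sup>2 \<le> 1 * K \<beta> m" unfolding power2_eq_square using K0 K2 by (intro mult_right_mono) auto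
    ultimately have P1: "P \<le> 1 + 2 * K \<beta> m" and P3: "P \<le> 3" using P K2 by linarith+
    have P0: "0 \<le> P" unfolding P_def by (intro prod_nonneg) (simp add: add_nonneg_nonneg)
    have ps: "partition_sum \<beta> m t \<le> P * exp (- \<beta> * (descent_cost m t - d * level r t))"
      if "0 \<le> t" "t \<le> 1/2" for t
      using partition_sum_le[OF d \<beta> that, of m] by (simp add: P_def \<gamma>_def)
    have "level r 0 = 0" by (rule level_0) simp
    hence ps0: "partition_sum \<beta> m 0 - 1 \<le> 2 * K \<beta> m"
      using ps[of 0] P1 by (simp add: descent_cost_def cost_def)
    define B where "B = {b. b \<le> H \<and> s - 1 / real H \<le> real b / real H \<and> real b / real H \<le> 1 / 2}"
    have "(\<Sum>\<xi>=1..(p - 1) div 2. exp (- \<beta> * (\<Sum>i<m. cost (2 ^ i * (real \<xi> / real p)))))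
      \<le> exp (2 * pi * \<beta> * s) * (partition_sum \<beta> m 0 - 1)
      + (\<Sum>b\<in>B. exp (2 * pi * \<beta> / real H) * partition_sum \<beta> m (real b / real H))"
      unfolding B_def using p pos s H by (intro character_sum_le) auto
    also have "\<dots> \<le> exp (2 * pi * \<beta> * s) * (2 * K \<beta> m) + (\<Sum>b\<in>B. 3 * exp (- \<beta> * (s\<^sup>2 / 4)))"
    proof (intro add_mono mult_left_mono ps0 sum_mono)
      fix b assume "b \<in> B"
      define c where "c = real b / real H"
      have "s - 1 / real H \<le> c" and c1: "c \<le> 1/2" using \<open>b \<in> B\<close> unfolding B_def c_def by blast+
      hence c: "s / 2 \<le> c" "c \<le> 1/2" using H2 by linarith+
      have "(s / 2)\<^sup>2 \<le> c\<^sup>2" using c s by (intro power_mono) auto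
      hence "s\<^sup>2 / 2 \<le> 2 * c\<^sup>2" by (simp add: power2_eq_square)
      also have "\<dots> \<le> descent_cost m c" using descent_cost_ge_square[of c "m - 1"] c s m by simp
      finally have f: "s\<^sup>2 / 2 \<le> descent_cost m c" .
      have "real (level r c) \<le> real r + 1" using level_le[of r c] by simp
      hence "d * level r c \<le> d * (real r + 1)" using d by (intro mult_left_mono) auto
      hence "s\<^sup>2 / 4 + 2 * pi / H \<le> descent_cost m c - d * level r c" using f drs H by linarith
      hence "\<beta> * (s\<^sup>2 / 4 + 2 * pi / H) \<le> \<beta> * (descent_cost m c - d * level r c)"
        using pos by (intro mult_left_mono) auto
      hence e: "exp (2 * pi * \<beta> / H) * exp (- \<beta> * (descent_cost m c - d * level r c)) \<le> exp (- \<beta> * (s\<^sup>2 / 4))"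
        by (simp add: algebra_simps flip: exp_add)
      have "exp (2 * pi * \<beta> / H) * partition_sum \<beta> m c
          \<le> exp (2 * pi * \<beta> / H) * (P * exp (- \<beta> * (descent_cost m c - d * level r c)))"
        using c s by (intro mult_left_mono ps) auto
      also have "\<dots> = P * (exp (2 * pi * \<beta> / H) * exp (- \<beta> * (descent_cost m c - d * level r c)))" by simp
      also have "\<dots> \<le> 3 * exp (- \<beta> * (s\<^sup>2 / 4))"
        by (intro mult_mono P3 e) auto
      finally show "exp (2 * pi * \<beta> / H) * partition_sum \<beta> m (real b / real H) \<le> 3 * exp (- \<beta> * (s\<^sup>2 / 4))"
        by (simp add: c_def)
    qed simp
    also have "(\<Sum>b\<in>B. 3 * exp (- \<beta> * (s\<^sup>2 / 4))) \<le> real (Suc H) * (3 * exp (- \<beta> * (s\<^sup>2 / 4)))"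
    proof -
      have "card B \<le> card {..H}" by (intro card_mono) (auto simp: B_def)
      hence "real (card B) \<le> real (Suc H)" by simp
      thus ?thesis by (simp only: sum_constant) (intro mult_right_mono, auto)
    qed
    finally show ?thesis by (simp only: mult_ac)
  qed
  have exp_powr: "exp (- (\<alpha> * ln m) * x) = real m powr (- \<alpha> * x)" if "0 < m" for m :: nat and x
    using that by (simp add: powr_def mult_ac)
  \<comment> \<open>The exponents of \<open>m\<close> in the three error terms.\<close>
  define e1 where "e1 = \<alpha> * (2 * pi * s - (2 - s))"
  define e2 where "e2 = 1 + \<alpha> * (2 * pi * s - (c0 - 2 * s))"
  define e3 where "e3 = - \<alpha> * (s\<^sup>2 / 4)"
  have pis: "2 * pi * s < 8 * s" using pi_less_4 s by (intro mult_strict_right_mono) auto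
  have "2 * pi * s - (2 - s) < 0" using pis s by linarith
  hence e1: "e1 < 0" unfolding e1_def using a0 by (intro mult_pos_neg)
  have e3: "e3 < 0" unfolding e3_def using a0 s by simp
  have e2: "e2 < 0"
  proof -
    have "2 * pi * s - (c0 - 2 * s) < - (1 / \<alpha>)" using pis s by linarith
    hence "\<alpha> * (2 * pi * s - (c0 - 2 * s)) < \<alpha> * (- (1 / \<alpha>))" using a0 by (rule mult_strict_left_mono)
    thus ?thesis using a0 by (simp add: e2_def)
  qed
  have eK: "exp (2 * pi * (\<alpha> * ln m) * s) * K (\<alpha> * ln m) m = k1 * real m powr e1 + real m powr e2" if m: "0 < m" for m :: nat
  proof -
    have "real m * exp (- (\<alpha> * ln m) * (c0 - 2 * s)) = exp (ln m + (- (\<alpha> * ln m) * (c0 - 2 * s)))"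
      using m by (simp only: exp_add exp_ln of_nat_0_less_iff)
    hence "exp (2 * pi * (\<alpha> * ln m) * s) * K (\<alpha> * ln m) m
      = k1 * exp (2 * pi * (\<alpha> * ln m) * s - (\<alpha> * ln m) * (2 - s)) + exp (2 * pi * (\<alpha> * ln m) * s + ln m - (\<alpha> * ln m) * (c0 - 2 * s))"
      unfolding K_def by (simp add: distrib_left exp_add exp_diff exp_minus field_simps)
    also have "\<dots> = k1 * real m powr e1 + real m powr e2"
      using m by (simp add: powr_def e1_def e2_def algebra_simps)
    finally show ?thesis .
  qed
  have lim: "(\<lambda>m. real m powr e) \<longlonglongrightarrow> 0" if "e < 0" for e
    using that by (intro tendsto_neg_powr filterlim_real_sequentially)
  have "(\<lambda>m. k1 * real m powr e1 + real m powr e2) \<longlonglongrightarrow> real k1 * 0 + 0"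
    by (intro tendsto_intros lim e1 e2)
  hence ev1: "\<forall>\<^sub>F m in at_top. k1 * real m powr e1 + real m powr e2 < min 1 (\<eta> / 4)"
    by (rule order_tendstoD) (use \<eta> in auto)
  have "(\<lambda>m. real (Suc H) * 3 * real m powr e3) \<longlonglongrightarrow> real (Suc H) * 3 * 0"
    by (intro tendsto_intros lim e3)
  hence ev2: "\<forall>\<^sub>F m in at_top. real (Suc H) * 3 * real m powr e3 < \<eta> / 2"
    by (rule order_tendstoD) (use \<eta> in auto)
  have "filterlim (\<lambda>m::nat. \<alpha> * ln m * d) at_top at_top"
    using a0 d by real_asymp
  hence ev3: "\<forall>\<^sub>F m::nat in at_top. ln 2 \<le> \<alpha> * ln m * d"
    by (simp add: filterlim_at_top)
  show ?thesis
    using ev1 ev2 ev3 eventually_gt_at_top[of 0]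
  proof eventually_elim
    case (elim m)
    show ?case
    proof (intro allI impI)
      fix p :: nat assume p: "odd p \<and> p < 2 ^ Suc m"
      have "(\<Sum>\<xi>=1..(p - 1) div 2. exp (- (\<alpha> * ln m) * (\<Sum>i<m. cost (2 ^ i * (real \<xi> / real p)))))
        \<le> 2 * (exp (2 * pi * (\<alpha> * ln m) * s) * K (\<alpha> * ln m) m) + real (Suc H) * 3 * exp (- (\<alpha> * ln m) * (s\<^sup>2 / 4))"
        using p elim eK[of m] by (intro bound) auto
      also have "\<dots> \<le> \<eta>" using elim eK[of m] exp_powr[of m "s\<^sup>2 / 4"] by (simp add: e3_def)
      finally show "(\<Sum>\<xi>=1..(p - 1) div 2. exp (- (\<alpha> * ln m) * (\<Sum>i<m. cost (2 ^ i * (real \<xi> / real p))))) \<le> \<eta>" .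
    qed
  qed
qed

section \<open>The walk on the integers and its characteristic function\<close>

primrec int_walk :: "int set \<Rightarrow> nat \<Rightarrow> int pmf" where
  "int_walk B 0 = return_pmf 0"
| "int_walk B (Suc n) = map_pmf (\<lambda>(x, y). x + y) (pair_pmf (int_walk B n) (pmf_of_set B))"

text \<open>
  The lift of the step set to the integers.
\<close>
definition dyadic_steps :: "nat \<Rightarrow> int set" where
  "dyadic_steps m = {0} \<union> (\<lambda>i. 2 ^ i) ` {..<m} \<union> (\<lambda>i. - (2 ^ i)) ` {..<m}"

lemma finite_dyadic_steps [simp]: "finite (dyadic_steps m)"
  and dyadic_steps_nonempty [simp]: "dyadic_steps m \<noteq> {}"
  by (auto simp: dyadic_steps_def)

lemma sum_dyadic_steps:
  "sum g (dyadic_steps m) = g 0 + (\<Sum>i<m. g (2 ^ i) + g (- (2 ^ i)))"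
proof -
  have neq: "(- (2 ^ i) :: int) \<noteq> 2 ^ j" for i j
    by (metis neg_0_less_iff_less not_less_iff_gr_or_eq order_less_trans zero_less_numeral zero_less_power)
  let ?P = "(\<lambda>i. 2 ^ i) ` {..<m} :: int set" and ?N = "(\<lambda>i. - (2 ^ i)) ` {..<m} :: int set"
  have "dyadic_steps m = insert 0 (?P \<union> ?N)" by (simp add: dyadic_steps_def)
  moreover have "0 \<notin> ?P \<union> ?N" by auto
  ultimately have "sum g (dyadic_steps m) = g 0 + sum g (?P \<union> ?N)" by (simp only: sum.insert finite_UnI finite_imageI finite_lessThan not_False_eq_True)
  also have "sum g (?P \<union> ?N) = sum g ?P + sum g ?N"
    using neq neq[symmetric] by (intro sum.union_disjoint) auto
  also have "sum g ?P = (\<Sum>i<m. g (2 ^ i))"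
    by (subst sum.reindex) (auto intro!: inj_onI)
  also have "sum g ?N = (\<Sum>i<m. g (- (2 ^ i)))"
    by (subst sum.reindex) (auto intro!: inj_onI)
  finally show ?thesis by (simp add: sum.distrib)
qed

lemma card_dyadic_steps [simp]: "card (dyadic_steps m) = 2 * m + 1"
  using sum_dyadic_steps[of "\<lambda>_. 1 :: nat" m] by simp

lemma finite_set_int_walk [simp]: "finite B \<Longrightarrow> B \<noteq> {} \<Longrightarrow> finite (set_pmf (int_walk B n))"
  by (induction n) auto

text \<open>
  Reduction modulo \<open>p\<close> commutes with convolution. Injectivity makes the image of the uniform
  measure on \<open>B\<close> uniform.
\<close>
lemma conv_power_eq_map_int_walk:
  assumes "finite B" "B \<noteq> {}" "inj_on (\<lambda>x. x mod p) B"
  shows "conv_power (residue_ring p) (pmf_of_set ((\<lambda>x. x mod p) ` B)) n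
       = map_pmf (\<lambda>x. x mod p) (int_walk B n)"
proof (induction n)
  case 0
  show ?case by (simp add: residue_ring_def)
next
  case (Suc n)
  have add: "x \<oplus>\<^bsub>residue_ring p\<^esub> y = (x + y) mod p" for x y
    by (simp add: residue_ring_def)
  have "pmf_of_set ((\<lambda>x. x mod p) ` B) = map_pmf (\<lambda>x. x mod p) (pmf_of_set B)"
    using assms by (simp add: map_pmf_of_set_inj)
  thus ?case
    using Suc.IH
    by (simp add: conv_pmf_def add pair_map_pmf1 pair_map_pmf2 pmf.map_comp o_def
        case_prod_unfold mod_add_eq)
qed

lemma expectation_finite:
  fixes f :: "'a \<Rightarrow> 'b::{banach, second_countable_topology}"
  assumes "finite (set_pmf M)"
  shows "measure_pmf.expectation M f = (\<Sum>a\<in>set_pmf M. pmf M a *\<^sub>R f a)"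
  by (rule integral_measure_pmf) (use assms in auto)

lemma expectation_pair_mult:
  fixes F :: "'a \<Rightarrow> 'c::{real_normed_field, banach, second_countable_topology}"
  assumes "finite (set_pmf M)" "finite (set_pmf N)"
  shows "measure_pmf.expectation (pair_pmf M N) (\<lambda>z. F (fst z) * G (snd z))
       = measure_pmf.expectation M F * measure_pmf.expectation N G"
proof -
  have "measure_pmf.expectation (pair_pmf M N) (\<lambda>z. F (fst z) * G (snd z))
      = (\<Sum>z\<in>set_pmf M \<times> set_pmf N. pmf (pair_pmf M N) z *\<^sub>R (F (fst z) * G (snd z)))"
    using expectation_finite[of "pair_pmf M N" "\<lambda>z. F (fst z) * G (snd z)"] assms by simp
  also have "\<dots> = (\<Sum>z\<in>set_pmf M \<times> set_pmf N. (pmf M (fst z) *\<^sub>R F (fst z)) * (pmf N (snd z) *\<^sub>R G (snd z)))"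
    by (intro sum.cong) (auto simp: pmf_pair)
  also have "\<dots> = measure_pmf.expectation M F * measure_pmf.expectation N G"
    using assms by (simp add: expectation_finite sum_product sum.cartesian_product case_prod_unfold)
  finally show ?thesis .
qed

definition char_fun :: "int pmf \<Rightarrow> real \<Rightarrow> complex" where
  "char_fun M \<theta> = measure_pmf.expectation M (\<lambda>x. cis (\<theta> * of_int x))"

lemma char_fun_int_walk:
  assumes "finite B" "B \<noteq> {}"
  shows "char_fun (int_walk B n) \<theta> = char_fun (pmf_of_set B) \<theta> ^ n"
proof (induction n)
  case 0
  show ?case by (simp add: char_fun_def)
next
  case (Suc n)
  have "char_fun (int_walk B (Suc n)) \<theta> =
      measure_pmf.expectation (pair_pmf (int_walk B n) (pmf_of_set B))
        (\<lambda>z. cis (\<theta> * of_int (fst z)) * cis (\<theta> * of_int (snd z)))"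
    by (simp add: char_fun_def case_prod_unfold distrib_left cis_mult)
  also have "\<dots> = char_fun (int_walk B n) \<theta> * char_fun (pmf_of_set B) \<theta>"
    unfolding char_fun_def using assms by (intro expectation_pair_mult) auto
  finally show ?case using Suc by simp
qed

lemma char_fun_dyadic_steps:
  "char_fun (pmf_of_set (dyadic_steps m)) \<theta> =
     of_real ((1 + 2 * (\<Sum>i<m. cos (\<theta> * 2 ^ i))) / (2 * m + 1))"
proof -
  have "char_fun (pmf_of_set (dyadic_steps m)) \<theta> =
      (\<Sum>x\<in>dyadic_steps m. cis (\<theta> * of_int x)) / of_nat (card (dyadic_steps m))"
    unfolding char_fun_def
    by (simp add: expectation_finite sum_divide_distrib scaleR_conv_of_real cong: sum.cong)
  also have "(\<Sum>x\<in>dyadic_steps m. cis (\<theta> * of_int x)) = 1 + (\<Sum>i<m. of_real (2 * cos (\<theta> * 2 ^ i)))"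
    unfolding sum_dyadic_steps by (intro arg_cong2[where f = "(+)"] sum.cong) (auto simp: complex_eq_iff)
  finally show ?thesis by (simp add: sum_distrib_left)
qed

text \<open>
  The characteristic function of one step at \<open>2 \<pi> x\<close>.
\<close>
definition dyadic_char :: "nat \<Rightarrow> real \<Rightarrow> real" where
  "dyadic_char m x = 1 - 2 / (2 * m + 1) * (\<Sum>i<m. cost (2 ^ i * x))"

lemma dyadic_char_eq: "dyadic_char m x = (1 + 2 * (\<Sum>i<m. cos (2 * pi * x * 2 ^ i))) / (2 * m + 1)"
proof -
  have "(\<Sum>i<m. cost (2 ^ i * x)) = m - (\<Sum>i<m. cos (2 * pi * x * 2 ^ i))"
    by (simp add: cost_def sum_subtractf mult_ac)
  thus ?thesis by (simp add: dyadic_char_def field_simps)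
qed

lemma char_fun_dyadic_walk:
  "char_fun (int_walk (dyadic_steps m) n) (2 * pi * x) = of_real (dyadic_char m x ^ n)"
  unfolding char_fun_int_walk[OF finite_dyadic_steps dyadic_steps_nonempty] char_fun_dyadic_steps
    dyadic_char_eq of_real_power ..

text \<open>
  A point and its double cannot both be close to \<open>1/2\<close>: with \<open>c = cos (2 \<pi> x)\<close> one has
  \<open>c + cos (4 \<pi> x) = 2 c\<^sup>2 + c - 1 \<ge> - 9/8\<close>. Averaging this along the orbit keeps the Fourier
  coefficients away from \<open>-1\<close>.
\<close>
lemma dyadic_char_ge:
  assumes "0 < m"
  shows "- 3 / 4 \<le> dyadic_char m x"
proof -
  define c where "c i = cos (2 * pi * x * 2 ^ i)" for i
  have dbl: "c (Suc i) = 2 * (c i)\<^sup>2 - 1" for i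
    using cos_double_cos[of "2 * pi * x * 2 ^ i"] by (simp add: c_def mult_ac)
  have "- 9 / 8 \<le> c i + c (Suc i)" for i
    using zero_le_power2[of "c i + 1 / 4"] unfolding dbl by (simp add: power2_eq_square algebra_simps)
  hence "(\<Sum>i<m. - 9 / 8) \<le> (\<Sum>i<m. c i + c (Suc i))" by (intro sum_mono)
  also have "\<dots> = 2 * (\<Sum>i<m. c i) + (\<Sum>i<m. c (Suc i) - c i)"
    by (simp add: sum.distrib sum_subtractf)
  also have "(\<Sum>i<m. c (Suc i) - c i) = c m - c 0" by (rule sum_lessThan_telescope)
  also have "c m - c 0 \<le> 1 - (- 1)" unfolding c_def by (intro diff_mono cos_le_one cos_ge_minus_one)
  finally have "- (9 / 8) * real m - 1 \<le> 1 + 2 * (\<Sum>i<m. c i)" by simp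
  moreover have "- (3 / 4) * (2 * real m + 1) \<le> - (9 / 8) * real m - 1"
  proof -
    have "1 \<le> real m" using assms by simp
    thus ?thesis by (simp add: field_simps)
  qed
  ultimately have "- 3 / 4 * (2 * real m + 1) \<le> 1 + 2 * (\<Sum>i<m. c i)" by linarith
  thus ?thesis unfolding dyadic_char_eq c_def by (simp add: le_divide_eq algebra_simps)
qed

section \<open>Total variation distance and Fourier coefficients\<close>

lemma sum_cis_eq_0:
  fixes p :: nat and d :: int
  assumes "0 < p" "\<not> int p dvd d"
  shows "(\<Sum>\<xi><p. cis (2 * pi * (real \<xi> / p) * of_int d)) = 0"
proof -
  define z where "z = cis (2 * pi * (of_int d / p))"
  have "real p * (2 * pi * (of_int d / p)) = 2 * pi * of_int d" using assms by simp
  hence "z ^ p = cis (2 * pi * of_int d)" by (simp only: z_def Complex.DeMoivre)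
  hence zp: "z ^ p = 1" by (simp add: cis_multiple_2pi)
  have "z \<noteq> 1"
  proof
    assume "z = 1"
    hence "cos (2 * pi * (of_int d / p)) = 1" by (simp add: z_def complex_eq_iff)
    then obtain n :: int where "2 * pi * (of_int d / p) = of_int n * 2 * pi"
      using cos_one_2pi_int by auto
    hence "of_int d = (of_int (n * int p) :: real)" using assms by (simp add: field_simps)
    hence "d = n * int p" by (simp only: of_int_eq_iff)
    thus False using assms by simp
  qed
  hence "(\<Sum>\<xi><p. z ^ \<xi>) = 0" using zp by (simp add: geometric_sum)
  also have "(\<Sum>\<xi><p. z ^ \<xi>) = (\<Sum>\<xi><p. cis (2 * pi * (real \<xi> / p) * of_int d))"
    by (simp add: z_def Complex.DeMoivre field_simps)
  finally show ?thesis .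
qed

lemma plancherel_mod:
  fixes p :: nat and P :: "int \<Rightarrow> real"
  assumes p: "0 < p"
  shows "(\<Sum>\<xi><p. (cmod (\<Sum>x\<in>{0..<int p}. P x *\<^sub>R cis (2 * pi * (real \<xi> / p) * of_int x)))\<^sup>2)
       = p * (\<Sum>x\<in>{0..<int p}. (P x)\<^sup>2)"
proof -
  let ?I = "{0..<int p}"
  let ?e = "\<lambda>\<xi> x. cis (2 * pi * (real \<xi> / p) * of_int x)"
  have sq: "of_real ((cmod (\<Sum>x\<in>?I. P x *\<^sub>R ?e \<xi> x))\<^sup>2) =
      (\<Sum>x\<in>?I. \<Sum>y\<in>?I. of_real (P x * P y) * ?e \<xi> (x - y))" for \<xi> :: nat
  proof -
    have "of_real ((cmod (\<Sum>x\<in>?I. P x *\<^sub>R ?e \<xi> x))\<^sup>2) =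
        (\<Sum>x\<in>?I. P x *\<^sub>R ?e \<xi> x) * cnj (\<Sum>x\<in>?I. P x *\<^sub>R ?e \<xi> x)"
      by (rule complex_norm_square)
    also have "\<dots> = (\<Sum>x\<in>?I. \<Sum>y\<in>?I. (P x *\<^sub>R ?e \<xi> x) * (P y *\<^sub>R ?e \<xi> (- y)))"
      by (simp add: cis_cnj sum_product)
    also have "\<dots> = (\<Sum>x\<in>?I. \<Sum>y\<in>?I. of_real (P x * P y) * ?e \<xi> (x - y))"
      by (intro sum.cong refl)
        (simp add: cis_mult scaleR_conv_of_real ring_distribs mult_ac flip: diff_divide_distrib)
    finally show ?thesis .
  qed
  have "of_real (\<Sum>\<xi><p. (cmod (\<Sum>x\<in>?I. P x *\<^sub>R ?e \<xi> x))\<^sup>2) =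
      (\<Sum>\<xi><p. \<Sum>x\<in>?I. \<Sum>y\<in>?I. of_real (P x * P y) * ?e \<xi> (x - y))"
    by (simp only: of_real_sum sq)
  also have "\<dots> = (\<Sum>x\<in>?I. \<Sum>\<xi><p. \<Sum>y\<in>?I. of_real (P x * P y) * ?e \<xi> (x - y))"
    by (rule sum.swap)
  also have "\<dots> = (\<Sum>x\<in>?I. \<Sum>y\<in>?I. \<Sum>\<xi><p. of_real (P x * P y) * ?e \<xi> (x - y))"
    by (intro sum.cong refl sum.swap)
  also have "\<dots> = (\<Sum>x\<in>?I. \<Sum>y\<in>?I. if y = x then of_real (p * (P x)\<^sup>2) else 0)"
  proof (intro sum.cong refl)
    fix x y assume xy: "x \<in> ?I" "y \<in> ?I"
    show "(\<Sum>\<xi><p. of_real (P x * P y) * ?e \<xi> (x - y)) = (if y = x then of_real (p * (P x)\<^sup>2) else 0)"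
    proof (cases "y = x")
      case False
      have "\<not> int p dvd x - y"
      proof
        assume "int p dvd x - y"
        hence "x mod int p = y mod int p" by (simp add: mod_eq_dvd_iff)
        thus False using xy False by simp
      qed
      hence "(\<Sum>\<xi><p. ?e \<xi> (x - y)) = 0" by (rule sum_cis_eq_0[OF p])
      thus ?thesis using False by (simp flip: sum_distrib_left)
    qed (simp add: power2_eq_square)
  qed
  also have "\<dots> = of_real (p * (\<Sum>x\<in>?I. (P x)\<^sup>2))"
    by (simp add: sum_distrib_left)
  finally show ?thesis by (simp only: of_real_eq_iff)
qed

lemma tv_dist_leI:
  assumes "\<And>S. \<bar>measure_pmf.prob \<mu> S - measure_pmf.prob \<nu> S\<bar> \<le> c"
  shows "tv_dist \<mu> \<nu> \<le> c"
  unfolding tv_dist_def by (rule cSUP_least) (use assms in auto)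

lemma tv_dist_geI: "measure_pmf.prob \<mu> S - measure_pmf.prob \<nu> S \<le> tv_dist \<mu> \<nu>"
proof -
  have "\<bar>measure_pmf.prob \<mu> S - measure_pmf.prob \<nu> S\<bar> \<le> tv_dist \<mu> \<nu>"
    unfolding tv_dist_def
  proof (rule cSUP_upper)
    have "\<bar>measure_pmf.prob \<mu> S - measure_pmf.prob \<nu> S\<bar> \<le> 1" for S
      using measure_pmf.prob_le_1[of \<mu> S] measure_pmf.prob_le_1[of \<nu> S]
        measure_nonneg[of \<mu> S] measure_nonneg[of \<nu> S] by linarith
    thus "bdd_above (range (\<lambda>S. \<bar>measure_pmf.prob \<mu> S - measure_pmf.prob \<nu> S\<bar>))"
      by (intro bdd_aboveI[of _ 1]) auto
  qed auto
  thus ?thesis by linarith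
qed

text \<open>
  The upper bound lemma of Diaconis and Shahshahani: the Cauchy-Schwarz inequality compares the
  \<open>L\<^sup>1\<close> distance with the \<open>L\<^sup>2\<close> distance to the uniform measure, which Plancherel evaluates.
\<close>
lemma tv_dist_le_char_fun:
  fixes p :: nat and M :: "int pmf"
  assumes p: "0 < p" and fin: "finite (set_pmf M)"
  shows "tv_dist (map_pmf (\<lambda>x. x mod int p) M) (pmf_of_set {0..<int p})
       \<le> sqrt (\<Sum>\<xi>=1..<p. (cmod (char_fun M (2 * pi * (real \<xi> / p))))\<^sup>2)"
proof -
  let ?I = "{0..<int p}"
  define \<mu> where "\<mu> = map_pmf (\<lambda>x. x mod int p) M"
  define u where "u = pmf_of_set ?I"
  have ne: "?I \<noteq> {}" using p by simp
  have s\<mu>: "set_pmf \<mu> \<subseteq> ?I" using p by (auto simp: \<mu>_def)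
  have su: "set_pmf u = ?I" using ne by (simp add: u_def)
  have pu: "pmf u x = 1 / p" if "x \<in> ?I" for x using that ne by (simp add: u_def)
  have cf: "char_fun M (2 * pi * (real \<xi> / p)) = (\<Sum>x\<in>?I. pmf \<mu> x *\<^sub>R cis (2 * pi * (real \<xi> / p) * of_int x))" for \<xi> :: nat
  proof -
    have eq: "cis (2 * pi * (real \<xi> / p) * of_int x) = cis (2 * pi * (real \<xi> / p) * of_int (x mod int p))" for x :: int
    proof -
      have "real_of_int x = real_of_int (x mod int p) + real p * real_of_int (x div int p)"
        using arg_cong[OF mod_mult_div_eq[of x "int p"], of real_of_int] by (metis of_int_add of_int_mult of_int_of_nat_eq)
      hence "2 * pi * (real \<xi> / p) * of_int x
        = 2 * pi * (real \<xi> / p) * (real_of_int (x mod int p) + real p * real_of_int (x div int p))" by (rule arg_cong)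
      also have "\<dots> = 2 * pi * (real \<xi> / p) * of_int (x mod int p) + 2 * pi * of_int (int \<xi> * (x div int p))"
        by (subst distrib_left) (use p in simp)
      finally have "cis (2 * pi * (real \<xi> / p) * of_int x)
        = cis (2 * pi * (real \<xi> / p) * of_int (x mod int p)) * cis (2 * pi * of_int (int \<xi> * (x div int p)))"
        by (simp only: cis_mult)
      thus ?thesis by (simp only: cis_multiple_2pi Ints_of_int mult_1_right)
    qed
    have "char_fun M (2 * pi * (real \<xi> / p)) = measure_pmf.expectation \<mu> (\<lambda>x. cis (2 * pi * (real \<xi> / p) * of_int x))"
      unfolding char_fun_def \<mu>_def integral_map_pmf
      by (intro Bochner_Integration.integral_cong refl eq)
    also have "\<dots> = (\<Sum>x\<in>?I. pmf \<mu> x *\<^sub>R cis (2 * pi * (real \<xi> / p) * of_int x))"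
      using s\<mu> by (intro integral_measure_pmf) auto
    finally show ?thesis .
  qed
  have tot: "(\<Sum>x\<in>?I. pmf \<mu> x) = 1" using s\<mu> by (intro sum_pmf_eq_1) auto
  have "(\<Sum>\<xi><p. (cmod (char_fun M (2 * pi * (real \<xi> / p))))\<^sup>2) = p * (\<Sum>x\<in>?I. (pmf \<mu> x)\<^sup>2)"
    unfolding cf by (rule plancherel_mod[OF p])
  moreover have "{..<p} = insert 0 {1..<p}" using p by auto
  moreover have "char_fun M 0 = 1" by (simp add: char_fun_def)
  ultimately have pl: "p * (\<Sum>x\<in>?I. (pmf \<mu> x)\<^sup>2) = 1 + (\<Sum>\<xi>=1..<p. (cmod (char_fun M (2 * pi * (real \<xi> / p))))\<^sup>2)"
    by simp
  have sq: "p * (\<Sum>x\<in>?I. (pmf \<mu> x - pmf u x)\<^sup>2) = (\<Sum>\<xi>=1..<p. (cmod (char_fun M (2 * pi * (real \<xi> / p))))\<^sup>2)"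
  proof -
    have "(\<Sum>x\<in>?I. (pmf \<mu> x - pmf u x)\<^sup>2) = (\<Sum>x\<in>?I. (pmf \<mu> x)\<^sup>2 - 2 / p * pmf \<mu> x + 1 / p\<^sup>2)"
      by (intro sum.cong refl) (simp add: pu power2_eq_square algebra_simps)
    also have "\<dots> = (\<Sum>x\<in>?I. (pmf \<mu> x)\<^sup>2) - 2 / p * 1 + p * (1 / p\<^sup>2)"
      by (simp only: sum.distrib sum_subtractf sum_distrib_left[symmetric] tot sum_constant) simp
    finally have "p * (\<Sum>x\<in>?I. (pmf \<mu> x - pmf u x)\<^sup>2) = p * (\<Sum>x\<in>?I. (pmf \<mu> x)\<^sup>2) - 1"
      using p by (simp add: field_simps power2_eq_square)
    thus ?thesis using pl by simp
  qed
  have "tv_dist \<mu> u \<le> (\<Sum>x\<in>?I. \<bar>pmf \<mu> x - pmf u x\<bar>)"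
  proof (rule tv_dist_leI)
    fix S
    have mS: "measure_pmf.prob q S = (\<Sum>x\<in>?I \<inter> S. pmf q x)" if "set_pmf q \<subseteq> ?I" for q :: "int pmf"
    proof -
      have "measure_pmf.prob q S = measure_pmf.prob q (?I \<inter> S)"
        using that by (intro measure_prob_cong_0) (auto simp: pmf_eq_0_set_pmf)
      also have "\<dots> = (\<Sum>x\<in>?I \<inter> S. pmf q x)" by (intro measure_measure_pmf_finite) auto
      finally show ?thesis .
    qed
    have "\<bar>measure_pmf.prob \<mu> S - measure_pmf.prob u S\<bar> = \<bar>\<Sum>x\<in>?I \<inter> S. pmf \<mu> x - pmf u x\<bar>"
      using s\<mu> su by (simp add: mS sum_subtractf)
    also have "\<dots> \<le> (\<Sum>x\<in>?I \<inter> S. \<bar>pmf \<mu> x - pmf u x\<bar>)" by (rule sum_abs)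
    also have "\<dots> \<le> (\<Sum>x\<in>?I. \<bar>pmf \<mu> x - pmf u x\<bar>)" by (intro sum_mono2) auto
    finally show "\<bar>measure_pmf.prob \<mu> S - measure_pmf.prob u S\<bar> \<le> (\<Sum>x\<in>?I. \<bar>pmf \<mu> x - pmf u x\<bar>)" .
  qed
  also have "\<dots> \<le> sqrt (p * (\<Sum>x\<in>?I. (pmf \<mu> x - pmf u x)\<^sup>2))"
  proof (rule real_le_rsqrt)
    have "(\<Sum>x\<in>?I. 1 * \<bar>pmf \<mu> x - pmf u x\<bar>)\<^sup>2 \<le> (\<Sum>x\<in>?I. 1\<^sup>2) * (\<Sum>x\<in>?I. \<bar>pmf \<mu> x - pmf u x\<bar>\<^sup>2)"
      by (rule Cauchy_Schwarz_ineq_sum)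
    thus "(\<Sum>x\<in>?I. \<bar>pmf \<mu> x - pmf u x\<bar>)\<^sup>2 \<le> p * (\<Sum>x\<in>?I. (pmf \<mu> x - pmf u x)\<^sup>2)" by simp
  qed
  finally show ?thesis unfolding sq unfolding \<mu>_def u_def .
qed

section \<open>A lower bound by the second moment method\<close>

lemma sum_cost_doubling: "(\<Sum>i<l. cost (2 ^ i / 2 ^ l * t)) = descent_cost l t"
proof -
  have "descent_cost l t = (\<Sum>i<l. cost (t / 2 ^ Suc (l - Suc i)))"
    unfolding descent_cost_def by (rule sum.nat_diff_reindex[symmetric])
  also have "\<dots> = (\<Sum>i<l. cost (2 ^ i / 2 ^ l * t))"
  proof (intro sum.cong refl)
    fix i assume "i \<in> {..<l}"
    hence "Suc (l - Suc i) + i = l" by simp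
    hence "(2 :: real) ^ l = 2 ^ Suc (l - Suc i) * 2 ^ i" by (metis power_add)
    thus "cost (t / 2 ^ Suc (l - Suc i)) = cost (2 ^ i / 2 ^ l * t)" by simp
  qed
  finally show ?thesis ..
qed

lemma cost_int_multiple: "k \<le> i \<Longrightarrow> cost (2 ^ i / 2 ^ k) = 0"
proof -
  assume "k \<le> i"
  then obtain j where "i = k + j" using le_Suc_ex by blast
  hence "(2 ^ i / 2 ^ k :: real) = of_int (2 ^ j)" by (simp add: power_add)
  thus ?thesis by (simp only: cost_int)
qed

lemma sum_cost_dyadic:
  assumes "k \<le> m"
  shows "(\<Sum>i<m. cost (2 ^ i * (1 / 2 ^ k))) = descent_cost k 1"
proof -
  have "(\<Sum>i<m. cost (2 ^ i * (1 / 2 ^ k))) = (\<Sum>i<k. cost (2 ^ i * (1 / 2 ^ k)))"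
    using assms by (intro sum.mono_neutral_right) (auto simp: cost_int_multiple)
  thus ?thesis using sum_cost_doubling[of k 1] by simp
qed

text \<open>
  Two excursions that begin at distant times hardly interact. The orbit of \<open>1 / 2^k - 1 / 2^l\<close> first
  follows a slightly shortened excursion of the larger summand \<open>1 / 2^l\<close>, and after it has become an
  integer only the excursion of \<open>1 / 2^k\<close> is left.
\<close>
lemma sum_cost_dyadic_diff:
  assumes "G \<le> l" "l + G \<le> k" "k \<le> m"
  shows "2 * c0 - 6 * pi / 2 ^ G \<le> (\<Sum>i<m. cost (2 ^ i * (1 / 2 ^ k - 1 / 2 ^ l)))"
proof -
  have k: "k = l + (k - l)" using assms by simp
  have pk: "(2::real) ^ k = 2 ^ l * 2 ^ (k - l)" using k by (metis power_add)
  have split: "{..<k} = {..<l} \<union> {l..<k}" using assms by auto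
  have "(\<Sum>i<l. cost (2 ^ i * (1 / 2 ^ k - 1 / 2 ^ l))) = (\<Sum>i<l. cost (2 ^ i / 2 ^ l * (1 - 1 / 2 ^ (k - l))))"
  proof (intro sum.cong refl)
    fix i
    have "2 ^ i * (1 / 2 ^ k - 1 / 2 ^ l) = - (2 ^ i / 2 ^ l * (1 - 1 / 2 ^ (k - l)) :: real)"
      by (simp add: pk field_simps)
    thus "cost (2 ^ i * (1 / 2 ^ k - 1 / 2 ^ l)) = cost (2 ^ i / 2 ^ l * (1 - 1 / 2 ^ (k - l)))" by simp
  qed
  also have "\<dots> = descent_cost l (1 - 1 / 2 ^ (k - l))" by (rule sum_cost_doubling)
  finally have 1: "(\<Sum>i<l. cost (2 ^ i * (1 / 2 ^ k - 1 / 2 ^ l))) = descent_cost l (1 - 1 / 2 ^ (k - l))" .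
  have "(\<Sum>i=l..<k. cost (2 ^ i * (1 / 2 ^ k - 1 / 2 ^ l))) = (\<Sum>i=0..<k - l. cost (2 ^ (i + l) * (1 / 2 ^ k - 1 / 2 ^ l)))"
    using sum.shift_bounds_nat_ivl[of "\<lambda>i. cost (2 ^ i * (1 / 2 ^ k - 1 / 2 ^ l))" 0 l "k - l"] assms by simp
  also have "\<dots> = (\<Sum>i<k - l. cost (2 ^ i / 2 ^ (k - l) * 1))"
    unfolding atLeast0LessThan
  proof (intro sum.cong refl)
    fix i
    have "2 ^ (i + l) * (1 / 2 ^ k - 1 / 2 ^ l) = 2 ^ i / 2 ^ (k - l) * 1 + (of_int (- (2 ^ i)) :: real)"
      by (simp add: pk field_simps power_add)
    thus "cost (2 ^ (i + l) * (1 / 2 ^ k - 1 / 2 ^ l)) = cost (2 ^ i / 2 ^ (k - l) * 1)"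
      by (simp only: cost_add_int)
  qed
  also have "\<dots> = descent_cost (k - l) 1" by (rule sum_cost_doubling)
  finally have 2: "(\<Sum>i=l..<k. cost (2 ^ i * (1 / 2 ^ k - 1 / 2 ^ l))) = descent_cost (k - l) 1" .
  have small: "2 * pi / 2 ^ j \<le> 2 * pi / 2 ^ G" if "G \<le> j" for j
    using that by (intro divide_left_mono power_increasing) auto
  have "c0 - 2 * pi / 2 ^ G \<le> descent_cost (k - l) 1"
    using c0_le_descent_cost_1[of "k - l"] small[of "k - l"] assms by linarith
  moreover have "c0 - 2 * pi / 2 ^ G - 2 * pi / 2 ^ G \<le> descent_cost l (1 - 1 / 2 ^ (k - l))"
  proof -
    have "\<bar>descent_cost l 1 - descent_cost l (1 - 1 / 2 ^ (k - l))\<bar> \<le> 2 * pi / 2 ^ (k - l)"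
      using descent_cost_lipschitz[of l 1 "1 - 1 / 2 ^ (k - l)"] by simp
    moreover have "G \<le> k - l" using assms by simp
    ultimately show ?thesis
      using c0_le_descent_cost_1[of l] small[of l] small[of "k - l"] assms(1) by linarith
  qed
  moreover have "descent_cost l (1 - 1 / 2 ^ (k - l)) + descent_cost (k - l) 1 = (\<Sum>i<k. cost (2 ^ i * (1 / 2 ^ k - 1 / 2 ^ l)))"
    unfolding split 1[symmetric] 2[symmetric] by (subst sum.union_disjoint) auto
  moreover have "\<dots> \<le> (\<Sum>i<m. cost (2 ^ i * (1 / 2 ^ k - 1 / 2 ^ l)))"
    using assms by (intro sum_mono2) auto
  ultimately show ?thesis by linarith
qed

definition trig_sum :: "real set \<Rightarrow> int \<Rightarrow> complex" where
  "trig_sum T x = (\<Sum>\<theta>\<in>T. cis (\<theta> * of_int x))"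

lemma expectation_trig_sum:
  assumes "finite (set_pmf M)"
  shows "measure_pmf.expectation M (trig_sum T) = (\<Sum>\<theta>\<in>T. char_fun M \<theta>)"
  using assms unfolding trig_sum_def char_fun_def
  by (intro Bochner_Integration.integral_sum integrable_measure_pmf_finite)

lemma second_moment_trig_sum:
  assumes "finite (set_pmf M)"
  shows "complex_of_real (measure_pmf.expectation M (\<lambda>x. (cmod (trig_sum T x))\<^sup>2))
     = (\<Sum>\<theta>\<in>T. \<Sum>\<phi>\<in>T. char_fun M (\<theta> - \<phi>))"
proof -
  have "complex_of_real ((cmod (trig_sum T x))\<^sup>2) = (\<Sum>\<theta>\<in>T. \<Sum>\<phi>\<in>T. cis ((\<theta> - \<phi>) * of_int x))" for x
    unfolding complex_norm_square trig_sum_def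
    by (simp add: sum_product cis_cnj cis_mult left_diff_distrib)
  hence "complex_of_real (measure_pmf.expectation M (\<lambda>x. (cmod (trig_sum T x))\<^sup>2))
      = measure_pmf.expectation M (\<lambda>x. \<Sum>\<theta>\<in>T. \<Sum>\<phi>\<in>T. cis ((\<theta> - \<phi>) * of_int x))"
    by (simp flip: integral_complex_of_real)
  also have "\<dots> = (\<Sum>\<theta>\<in>T. \<Sum>\<phi>\<in>T. char_fun M (\<theta> - \<phi>))"
    unfolding char_fun_def using assms
    by (simp add: Bochner_Integration.integral_sum integrable_measure_pmf_finite)
  finally show ?thesis .
qed

lemma prob_ge_le_expectation:
  fixes h :: "'a \<Rightarrow> real"
  assumes "finite (set_pmf M)" "\<And>x. 0 \<le> h x" "0 < c"
  shows "measure_pmf.prob M {x. c \<le> h x} \<le> measure_pmf.expectation M h / c"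
  using integral_Markov_inequality_measure[of "measure_pmf M" h UNIV c] assms
  by (simp add: integrable_measure_pmf_finite)

lemma second_moment_le:
  assumes "finite (set_pmf M)" "finite T"
    and "\<And>\<theta> \<phi>. \<theta> \<in> T \<Longrightarrow> \<phi> \<in> T \<Longrightarrow> \<theta> \<noteq> \<phi> \<Longrightarrow> cmod (char_fun M (\<theta> - \<phi>)) \<le> v" "0 \<le> v"
  shows "measure_pmf.expectation M (\<lambda>x. (cmod (trig_sum T x))\<^sup>2) \<le> card T + (real (card T))\<^sup>2 * v"
proof -
  have "measure_pmf.expectation M (\<lambda>x. (cmod (trig_sum T x))\<^sup>2)
      = cmod (\<Sum>\<theta>\<in>T. \<Sum>\<phi>\<in>T. char_fun M (\<theta> - \<phi>))"
    unfolding second_moment_trig_sum[OF assms(1), symmetric] by (simp add: integral_nonneg_AE)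
  also have "\<dots> \<le> (\<Sum>\<theta>\<in>T. \<Sum>\<phi>\<in>T. cmod (char_fun M (\<theta> - \<phi>)))"
    by (intro order_trans[OF norm_sum] sum_mono norm_sum)
  also have "\<dots> \<le> (\<Sum>\<theta>\<in>T. \<Sum>\<phi>\<in>T. (if \<phi> = \<theta> then 1 else 0) + v)"
    using assms(3,4) by (intro sum_mono) (auto simp: char_fun_def)
  also have "\<dots> = card T + (real (card T))\<^sup>2 * v"
    using assms(2) by (simp add: sum.distrib power2_eq_square algebra_simps)
  finally show ?thesis .
qed

text \<open>
  Chebyshev's inequality when the second moment is at most \<open>s\<close> times the square of a lower bound
  \<open>b\<close> of the mean.
\<close>
lemma chebyshev_trig_sum:
  assumes fin: "finite (set_pmf M)"
    and a: "measure_pmf.expectation M (trig_sum T) = of_real a" "0 < b" "b \<le> a"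
    and s: "measure_pmf.expectation M (\<lambda>x. (cmod (trig_sum T x))\<^sup>2) \<le> s * b\<^sup>2" "1 \<le> s"
  shows "measure_pmf.prob M {x. cmod (trig_sum T x) < b / 2} \<le> 4 * (s - 1)"
proof -
  let ?E = "measure_pmf.expectation M"
  have int: "integrable M h" for h :: "int \<Rightarrow> real" using fin by (rule integrable_measure_pmf_finite)
  have intc: "integrable M (trig_sum T)" using fin by (rule integrable_measure_pmf_finite)
  have a0: "0 < a" using a by linarith
  have "?E (\<lambda>x. Re (trig_sum T x)) = a" using integral_Re[OF intc] a by simp
  moreover have "(cmod (trig_sum T x - of_real a))\<^sup>2 = (cmod (trig_sum T x))\<^sup>2 - 2 * a * Re (trig_sum T x) + a\<^sup>2" for x
    unfolding cmod_power2 by (simp add: power2_eq_square algebra_simps)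
  ultimately have var: "?E (\<lambda>x. (cmod (trig_sum T x - of_real a))\<^sup>2) = ?E (\<lambda>x. (cmod (trig_sum T x))\<^sup>2) - a\<^sup>2"
    using int by (simp add: power2_eq_square)
  have "b\<^sup>2 \<le> a\<^sup>2" using a by (intro power_mono) auto
  hence "s * b\<^sup>2 \<le> s * a\<^sup>2" using s by (intro mult_left_mono) auto
  hence v: "?E (\<lambda>x. (cmod (trig_sum T x - of_real a))\<^sup>2) \<le> (s - 1) * a\<^sup>2"
    unfolding var left_diff_distrib using s(1) by linarith
  have "{x. cmod (trig_sum T x) < b / 2} \<subseteq> {x. (a / 2)\<^sup>2 \<le> (cmod (trig_sum T x - of_real a))\<^sup>2}"
  proof clarify
    fix x assume "cmod (trig_sum T x) < b / 2"
    hence "cmod (trig_sum T x) < a / 2" using a by linarith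
    moreover have "a \<le> cmod (trig_sum T x) + cmod (trig_sum T x - of_real a)"
      using norm_triangle_ineq4[of "trig_sum T x" "trig_sum T x - of_real a"] a0 by simp
    ultimately have "a / 2 \<le> cmod (trig_sum T x - of_real a)" by linarith
    thus "(a / 2)\<^sup>2 \<le> (cmod (trig_sum T x - of_real a))\<^sup>2" using a0 by (intro power_mono) auto
  qed
  hence "measure_pmf.prob M {x. cmod (trig_sum T x) < b / 2}
      \<le> measure_pmf.prob M {x. (a / 2)\<^sup>2 \<le> (cmod (trig_sum T x - of_real a))\<^sup>2}"
    by (intro measure_pmf.finite_measure_mono) auto
  also have "\<dots> \<le> ?E (\<lambda>x. (cmod (trig_sum T x - of_real a))\<^sup>2) / (a / 2)\<^sup>2"
    using fin a0 by (intro prob_ge_le_expectation) auto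
  also have "\<dots> \<le> (s - 1) * a\<^sup>2 / (a / 2)\<^sup>2" using v by (intro divide_right_mono) auto
  also have "\<dots> = 4 * (s - 1)" using a0 by (simp add: power2_eq_square)
  finally show ?thesis .
qed

text \<open>
  A geometric series; translating the interval by \<open>c\<close> multiplies it by a phase.
\<close>
lemma cmod_char_fun_interval_le:
  fixes p :: nat and \<alpha> :: real
  assumes p: "0 < p" and \<alpha>: "0 < \<bar>\<alpha>\<bar>" "\<bar>\<alpha>\<bar> \<le> 1/2"
  shows "cmod (char_fun (map_pmf (\<lambda>x. x + c) (pmf_of_set {0..<int p})) (2 * pi * \<alpha>)) \<le> 1 / (2 * p * \<bar>\<alpha>\<bar>)"
proof -
  define z where "z = cis (2 * pi * \<alpha>)"
  have "char_fun (map_pmf (\<lambda>x. x + c) (pmf_of_set {0..<int p})) (2 * pi * \<alpha>)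
      = (\<Sum>x\<in>{0..<int p}. cis (2 * pi * \<alpha> * of_int c) * cis (2 * pi * \<alpha> * of_int x) / p)"
    unfolding char_fun_def integral_map_pmf using p
    by (subst expectation_finite) (auto simp: scaleR_conv_of_real distrib_left cis_mult add.commute intro!: sum.cong)
  also have "\<dots> = cis (2 * pi * \<alpha> * of_int c) / p * (\<Sum>x\<in>{0..<int p}. cis (2 * pi * \<alpha> * of_int x))"
    by (simp add: sum_distrib_left)
  also have "(\<Sum>x\<in>{0..<int p}. cis (2 * pi * \<alpha> * of_int x)) = (\<Sum>x<p. cis (2 * pi * \<alpha> * real x))"
    by (rule sum.reindex_bij_witness[of _ int nat]) auto
  also have "\<dots> = (\<Sum>x<p. z ^ x)" by (simp add: z_def Complex.DeMoivre mult_ac)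
  finally have "cmod (char_fun (map_pmf (\<lambda>x. x + c) (pmf_of_set {0..<int p})) (2 * pi * \<alpha>)) = cmod (\<Sum>x<p. z ^ x) / p"
    by (simp add: norm_mult norm_divide)
  moreover have z1: "4 * \<bar>\<alpha>\<bar> \<le> cmod (z - 1)"
  proof -
    have "2 * \<bar>\<alpha>\<bar> \<le> sin (pi * (2 * \<bar>\<alpha>\<bar>) / 2)" using \<alpha> by (intro sin_half_pi_ge) auto
    hence "2 * \<bar>\<alpha>\<bar> \<le> \<bar>sin (pi * \<alpha>)\<bar>"
      by (cases "0 \<le> \<alpha>") auto
    moreover have "cmod (z - 1) = 2 * \<bar>sin (pi * \<alpha>)\<bar>"
    proof -
      have "(cmod (z - 1))\<^sup>2 = (2 * \<bar>sin (pi * \<alpha>)\<bar>)\<^sup>2"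
      proof -
        have "(cmod (z - 1))\<^sup>2 = (cos (2 * pi * \<alpha>) - 1)\<^sup>2 + (sin (2 * pi * \<alpha>))\<^sup>2"
          by (simp add: z_def cmod_power2)
        also have "\<dots> = 2 - 2 * cos (2 * (pi * \<alpha>))"
          using sin_cos_squared_add[of "2 * pi * \<alpha>"] by (simp add: power2_eq_square algebra_simps)
        also have "\<dots> = 4 * (sin (pi * \<alpha>))\<^sup>2" by (simp add: cos_double_sin)
        finally show ?thesis by (simp add: power_mult_distrib)
      qed
      thus ?thesis by (rule power2_eq_imp_eq) auto
    qed
    ultimately show ?thesis by linarith
  qed
  moreover have "cmod (\<Sum>x<p. z ^ x) \<le> 2 / (4 * \<bar>\<alpha>\<bar>)"
  proof -
    have "z \<noteq> 1" using z1 \<alpha> by auto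
    hence "cmod (\<Sum>x<p. z ^ x) = cmod (z ^ p - 1) / cmod (z - 1)" by (simp add: geometric_sum norm_divide)
    also have "\<dots> \<le> 2 / (4 * \<bar>\<alpha>\<bar>)"
    proof (rule frac_le)
      have "cmod (z ^ p - 1) \<le> cmod (z ^ p) + cmod 1" by (rule norm_triangle_ineq4)
      also have "cmod (z ^ p) = 1" by (simp add: z_def norm_power)
      finally show "cmod (z ^ p - 1) \<le> 2" by simp
    qed (use z1 \<alpha> in auto)
    finally show ?thesis .
  qed
  ultimately have "cmod (char_fun (map_pmf (\<lambda>x. x + c) (pmf_of_set {0..<int p})) (2 * pi * \<alpha>)) \<le> 2 / (4 * \<bar>\<alpha>\<bar>) / p"
    using p by (simp only: divide_right_mono of_nat_0_le_iff)
  also have "\<dots> = 1 / (2 * p * \<bar>\<alpha>\<bar>)" by simp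
  finally show ?thesis .
qed

lemma int_walk_second_moment:
  assumes B: "finite B" "B \<noteq> {}"
    and E1: "measure_pmf.expectation (pmf_of_set B) real_of_int = 0"
  shows "measure_pmf.expectation (int_walk B n) (\<lambda>x. (real_of_int x)\<^sup>2)
       = n * measure_pmf.expectation (pmf_of_set B) (\<lambda>x. (real_of_int x)\<^sup>2)"
proof (induction n)
  case (Suc n)
  let ?P = "pair_pmf (int_walk B n) (pmf_of_set B)"
  have fin: "finite (set_pmf (int_walk B n))" "finite (set_pmf (pmf_of_set B))" using B by auto
  have int: "integrable ?P h" for h :: "_ \<Rightarrow> real"
    using fin by (intro integrable_measure_pmf_finite) simp
  have "measure_pmf.expectation (int_walk B (Suc n)) (\<lambda>x. (real_of_int x)\<^sup>2)
      = measure_pmf.expectation ?P (\<lambda>z. (real_of_int (fst z))\<^sup>2 * 1 + (2 * real_of_int (fst z)) * real_of_int (snd z) + 1 * (real_of_int (snd z))\<^sup>2)"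
    by (simp add: case_prod_unfold power2_eq_square algebra_simps)
  also have "\<dots> = measure_pmf.expectation ?P (\<lambda>z. (real_of_int (fst z))\<^sup>2 * 1)
      + measure_pmf.expectation ?P (\<lambda>z. (2 * real_of_int (fst z)) * real_of_int (snd z))
      + measure_pmf.expectation ?P (\<lambda>z. 1 * (real_of_int (snd z))\<^sup>2)"
    by (simp only: Bochner_Integration.integral_add[OF int int])
  also have "\<dots> = measure_pmf.expectation (int_walk B n) (\<lambda>x. (real_of_int x)\<^sup>2)
      + measure_pmf.expectation (pmf_of_set B) (\<lambda>x. (real_of_int x)\<^sup>2)"
    using expectation_pair_mult[OF fin, of "\<lambda>x. (real_of_int x)\<^sup>2" "\<lambda>_. 1"]
      expectation_pair_mult[OF fin, of "\<lambda>x. 2 * real_of_int x" real_of_int]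
      expectation_pair_mult[OF fin, of "\<lambda>_. 1" "\<lambda>x. (real_of_int x)\<^sup>2"] E1 by simp
  finally show ?case using Suc by (simp add: algebra_simps)
qed simp

lemma dyadic_walk_second_moment_le:
  "measure_pmf.expectation (int_walk (dyadic_steps m) n) (\<lambda>x. (real_of_int x)\<^sup>2) \<le> real n * (4 ^ m / real (2 * m + 1))"
proof -
  have "measure_pmf.expectation (pmf_of_set (dyadic_steps m)) real_of_int = 0"
    by (subst integral_pmf_of_set) (auto simp: sum_dyadic_steps)
  hence "measure_pmf.expectation (int_walk (dyadic_steps m) n) (\<lambda>x. (real_of_int x)\<^sup>2)
      = n * measure_pmf.expectation (pmf_of_set (dyadic_steps m)) (\<lambda>x. (real_of_int x)\<^sup>2)"
    by (intro int_walk_second_moment) auto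
  also have "measure_pmf.expectation (pmf_of_set (dyadic_steps m)) (\<lambda>x. (real_of_int x)\<^sup>2)
      = (\<Sum>i<m. 2 * 4 ^ i) / (2 * m + 1)"
  proof -
    have "((2 :: real) ^ i)\<^sup>2 = 4 ^ i" for i
      by (simp add: power2_eq_square flip: power_mult_distrib)
    thus ?thesis by (subst integral_pmf_of_set) (auto simp: sum_dyadic_steps)
  qed
  also have "(\<Sum>i<m. 2 * 4 ^ i) \<le> (4 ^ m :: real)"
  proof (induction m)
    case (Suc m)
    thus ?case using zero_le_power[of "4 :: real" m]
      unfolding sum.lessThan_Suc power_Suc by linarith
  qed simp
  finally show ?thesis by (simp add: divide_right_mono mult_left_mono add.commute)
qed

lemma dyadic_char_minus [simp]: "dyadic_char m (- x) = dyadic_char m x"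
  by (simp add: dyadic_char_def)

text \<open>
  The test statistic is \<open>f(x) = \<Sum>j. exp (2 \<pi> i x / 2^(G j))\<close> for \<open>1 \<le> j \<le> R\<close>. Under the lifted walk
  its mean is at least \<open>R q^n\<close>, and the gap \<open>G\<close> makes the characters nearly uncorrelated. Under the
  uniform measure on any interval of length \<open>p\<close> its second moment is at most \<open>2 R\<close>, because all
  frequencies \<open>1 / 2^(G j)\<close> are at least \<open>1 / 2^(m / 2)\<close>. The distinguishing set consists of the residues
  for which some lift \<open>x + j p\<close> with \<open>\<bar>j\<bar> \<le> J\<close> has \<open>\<bar>f\<bar> \<ge> R q^n / 2\<close>; the error terms account in turn for
  the concentration of \<open>f\<close>, for lifts with \<open>\<bar>Y\<bar> \<ge> J p\<close>, and for the union bound over \<open>j\<close>.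
\<close>
lemma tv_lower_bound:
  fixes m G R J n p :: nat and q :: real
  assumes m: "0 < m" and G: "0 < G" and R: "0 < R" and GR: "2 * (G * R) \<le> m"
    and p: "2 ^ m < 2 * p" and J: "0 < J"
  defines "q \<equiv> 1 - 2 * c0 / (2 * m + 1)"
  assumes q: "0 < q" "1 / 2 \<le> q\<^sup>2"
    and u: "3 / 4 \<le> 1 - 2 / (2 * m + 1) * (2 * c0 - 6 * pi / 2 ^ G)"
  shows "1 - 4 * (1 / (R * q ^ (2 * n)) + exp (48 * n / (2 ^ G * m)) - 1) - 2 * n / (m * J\<^sup>2)
      - (2 * J + 1) * 8 / (R * q ^ (2 * n))
    \<le> tv_dist (map_pmf (\<lambda>x. x mod int p) (int_walk (dyadic_steps m) n)) (pmf_of_set {0..<int p})"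
proof -
  define M where "M = int_walk (dyadic_steps m) n"
  have finM: "finite (set_pmf M)" by (simp add: M_def)
  have p0: "0 < p" using p by (auto intro: Nat.gr0I)
  have pr: "(2 :: real) ^ m < 2 * real p" using p by (metis of_nat_less_iff of_nat_mult of_nat_numeral of_nat_power)
  define \<theta> where "\<theta> j = 2 * pi * (1 / 2 ^ (G * j))" for j :: nat
  define T where "T = \<theta> ` {1..R}"
  have inj: "inj_on \<theta> {1..R}" using G by (auto intro!: inj_onI simp: \<theta>_def)
  have finT: "finite T" and cardT: "card T = R" using card_image[OF inj] by (simp_all add: T_def)
  have Gj: "G * j \<le> G * R" if "j \<in> {1..R}" for j using that by simp
  have Gm: "G * j \<le> m" if "j \<in> {1..R}" for j using Gj[OF that] GR by linarith
  define s where "s = exp (48 * n / (2 ^ G * m))"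
  define b where "b = R * q ^ n"
  have b0: "0 < b" using R q by (simp add: b_def)
  have b2: "b\<^sup>2 = (real R)\<^sup>2 * q ^ (2 * n)" by (simp add: b_def power_mult_distrib power_mult mult.commute)
  define Q where "Q = real R * q ^ (2 * n)"
  have Q0: "0 < Q" using R q by (simp add: Q_def)
  have b2': "b\<^sup>2 = R * Q" unfolding b2 Q_def by (simp add: power2_eq_square)
  \<comment> \<open>The second moment under the walk is at most \<open>\<sigma> b\<^sup>2\<close>: the diagonal contributes \<open>R = b\<^sup>2 / Q\<close>, and
    \<open>s\<close> bounds the relative excess of the correlations.\<close>
  define \<sigma> where "\<sigma> = 1 / Q + s"
  have "1 \<le> s" unfolding s_def by simp
  hence \<sigma>1: "1 \<le> \<sigma>" using Q0 by (simp add: \<sigma>_def add_increasing)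
  have offdiag: "\<exists>i l. i \<in> {1..R} \<and> l \<in> {1..R} \<and> i < l \<and> (\<theta>' - \<phi> = 2 * pi * (1 / 2 ^ (G * l) - 1 / 2 ^ (G * i)) \<or>
      \<theta>' - \<phi> = 2 * pi * - (1 / 2 ^ (G * l) - 1 / 2 ^ (G * i)))"
    if th: "\<theta>' \<in> T" "\<phi> \<in> T" "\<theta>' \<noteq> \<phi>" for \<theta>' \<phi>
  proof -
    obtain i l where il: "i \<in> {1..R}" "l \<in> {1..R}" "\<theta>' = \<theta> i" "\<phi> = \<theta> l"
      using th by (auto simp: T_def)
    hence "i \<noteq> l" using th by auto
    thus ?thesis
    proof (cases "i < l")
      case True
      thus ?thesis using il by (intro exI[of _ i] exI[of _ l]) (auto simp: \<theta>_def algebra_simps)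
    next
      case False
      thus ?thesis using il \<open>i \<noteq> l\<close> by (intro exI[of _ l] exI[of _ i]) (auto simp: \<theta>_def algebra_simps)
    qed
  qed
  have cfM: "char_fun M (2 * pi * x) = of_real (dyadic_char m x ^ n)" for x
    unfolding M_def by (rule char_fun_dyadic_walk)

  have walk_far: "measure_pmf.prob M {x. cmod (trig_sum T x) < b / 2} \<le> 4 * (\<sigma> - 1)"
  proof (rule chebyshev_trig_sum[OF finM _ b0])
    define a where "a = (\<Sum>j=1..R. dyadic_char m (1 / 2 ^ (G * j)) ^ n)"
    have "(\<Sum>\<theta>'\<in>T. char_fun M \<theta>') = (\<Sum>j=1..R. char_fun M (\<theta> j))"
      unfolding T_def sum.reindex[OF inj] o_def ..
    also have "\<dots> = of_real a" unfolding \<theta>_def cfM a_def by simp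
    finally show "measure_pmf.expectation M (trig_sum T) = of_real a"
      by (simp only: expectation_trig_sum[OF finM])
    have "(\<Sum>j=1..R. q ^ n) \<le> a"
      unfolding a_def
    proof (rule sum_mono)
      fix j assume "j \<in> {1..R}"
      hence "dyadic_char m (1 / 2 ^ (G * j)) = 1 - 2 / (2 * m + 1) * descent_cost (G * j) 1"
        unfolding dyadic_char_def using sum_cost_dyadic[OF Gm] by simp
      also have "\<dots> \<ge> 1 - 2 / (2 * m + 1) * c0"
        by (intro diff_left_mono mult_left_mono descent_cost_1_le) auto
      finally have "q \<le> dyadic_char m (1 / 2 ^ (G * j))" by (simp add: q_def)
      thus "q ^ n \<le> dyadic_char m (1 / 2 ^ (G * j)) ^ n" using q by (intro power_mono) auto
    qed
    thus "b \<le> a" by (simp add: b_def)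
    define v where "v = q ^ (2 * n) * s"
    have "measure_pmf.expectation M (\<lambda>x. (cmod (trig_sum T x))\<^sup>2) \<le> card T + (real (card T))\<^sup>2 * v"
    proof (rule second_moment_le[OF finM finT])
      fix \<theta>' \<phi> assume "\<theta>' \<in> T" "\<phi> \<in> T" "\<theta>' \<noteq> \<phi>"
      from offdiag[OF this] obtain i l where il: "i \<in> {1..R}" "l \<in> {1..R}" "i < l"
        and d: "\<theta>' - \<phi> = 2 * pi * (1 / 2 ^ (G * l) - 1 / 2 ^ (G * i)) \<or> \<theta>' - \<phi> = 2 * pi * - (1 / 2 ^ (G * l) - 1 / 2 ^ (G * i))"
        by blast
      define x where "x = 1 / 2 ^ (G * l) - (1 / 2 ^ (G * i) :: real)"
      define U where "U = 1 - 2 / (2 * m + 1) * (2 * c0 - 6 * pi / 2 ^ G)"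
      have "G * i + G \<le> G * l"
      proof -
        have "G * (i + 1) \<le> G * l" using il by (intro mult_left_mono) auto
        thus ?thesis by simp
      qed
      moreover have "G \<le> G * i" using il by simp
      ultimately have S: "2 * c0 - 6 * pi / 2 ^ G \<le> (\<Sum>k<m. cost (2 ^ k * x))"
        unfolding x_def using Gm[OF il(2)] by (intro sum_cost_dyadic_diff) auto
      have "dyadic_char m x \<le> U" unfolding dyadic_char_def U_def
        using mult_left_mono[OF S, of "2 / (2 * real m + 1)"] by (simp add: add.commute)
      moreover have "3 / 4 \<le> U" using u by (simp only: U_def)
      ultimately have "\<bar>dyadic_char m x\<bar> \<le> U" using dyadic_char_ge[OF m, of x] by linarith
      \<comment> \<open>\<open>U\<close> exceeds \<open>1 - 4 c0 / (2 m + 1) \<le> q\<^sup>2\<close> by \<open>12 \<pi> / (2^G (2 m + 1))\<close>, and \<open>q\<^sup>2 \<ge> 1/2\<close>.\<close>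
      have "U \<le> q\<^sup>2 * exp (48 / (2 ^ G * m))"
      proof -
        have "q\<^sup>2 = 1 - 4 * c0 / (2 * m + 1) + (2 * c0 / (2 * m + 1))\<^sup>2"
          by (simp add: q_def power2_eq_square algebra_simps)
        hence "U \<le> q\<^sup>2 + 2 / (2 * m + 1) * (6 * pi / 2 ^ G)"
          by (simp add: U_def right_diff_distrib)
        also have "2 / (2 * m + 1) * (6 * pi / 2 ^ G) \<le> 2 / (2 * m) * (6 * 4 / 2 ^ G)"
          using m pi_less_4 by (intro mult_mono divide_left_mono divide_right_mono) auto
        also have "\<dots> = 1 / 2 * (48 / (2 ^ G * m))" using m by simp
        also have "\<dots> \<le> q\<^sup>2 * (48 / (2 ^ G * m))" using q by (intro mult_right_mono) auto
        also have "q\<^sup>2 + q\<^sup>2 * (48 / (2 ^ G * m)) = q\<^sup>2 * (1 + 48 / (2 ^ G * m))" by (simp add: algebra_simps)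
        also have "\<dots> \<le> q\<^sup>2 * exp (48 / (2 ^ G * m))"
          by (intro mult_left_mono exp_ge_add_one_self) auto
        finally show ?thesis by simp
      qed
      hence "\<bar>dyadic_char m x\<bar> ^ n \<le> (q\<^sup>2 * exp (48 / (2 ^ G * m))) ^ n"
        using \<open>\<bar>dyadic_char m x\<bar> \<le> U\<close> by (intro power_mono) auto
      also have "\<dots> = v"
        by (simp add: v_def s_def power_mult_distrib power_mult exp_of_nat_mult[symmetric])
      finally have "\<bar>dyadic_char m x\<bar> ^ n \<le> v" .
      moreover have "char_fun M (\<theta>' - \<phi>) = of_real (dyadic_char m x ^ n)"
        using d cfM[of x] cfM[of "- x"] unfolding x_def[symmetric] by (metis dyadic_char_minus)
      ultimately show "cmod (char_fun M (\<theta>' - \<phi>)) \<le> v" by (simp add: norm_power)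
    next
      show "0 \<le> v" using q by (simp add: v_def s_def)
    qed
    also have "\<dots> = \<sigma> * b\<^sup>2" using Q0 q R unfolding cardT \<sigma>_def b2' v_def by (simp add: Q_def power2_eq_square algebra_simps)
    finally show "measure_pmf.expectation M (\<lambda>x. (cmod (trig_sum T x))\<^sup>2) \<le> \<sigma> * b\<^sup>2" .
  qed (rule \<sigma>1)

  have walk_large: "measure_pmf.prob M {x. int J * int p \<le> \<bar>x\<bar>} \<le> 2 * n / (m * J\<^sup>2)"
  proof -
    have "{x. int J * int p \<le> \<bar>x\<bar>} \<subseteq> {x. (real J * real p)\<^sup>2 \<le> (real_of_int x)\<^sup>2}"
    proof clarify
      fix x assume "int J * int p \<le> \<bar>x\<bar>"
      hence "real_of_int (int J * int p) \<le> real_of_int \<bar>x\<bar>" by (simp only: of_int_le_iff)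
      thus "(real J * real p)\<^sup>2 \<le> (real_of_int x)\<^sup>2" by (simp add: abs_le_square_iff[symmetric])
    qed
    hence "measure_pmf.prob M {x. int J * int p \<le> \<bar>x\<bar>} \<le> measure_pmf.prob M {x. (real J * real p)\<^sup>2 \<le> (real_of_int x)\<^sup>2}"
      by (intro measure_pmf.finite_measure_mono) auto
    also have "\<dots> \<le> measure_pmf.expectation M (\<lambda>x. (real_of_int x)\<^sup>2) / (real J * real p)\<^sup>2"
      using J p0 by (intro prob_ge_le_expectation finM) auto
    also have "\<dots> \<le> real n * (4 ^ m / real (2 * m + 1)) / (real J * real p)\<^sup>2"
      unfolding M_def by (intro divide_right_mono dyadic_walk_second_moment_le) auto
    also have "\<dots> \<le> n * (4 * (real p)\<^sup>2 / (2 * m)) / (real J * real p)\<^sup>2"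
    proof (intro divide_right_mono mult_left_mono frac_le)
      have "((2::real) ^ m)\<^sup>2 \<le> (2 * real p)\<^sup>2" using pr by (intro power_mono) auto
      moreover have "((2::real) ^ m)\<^sup>2 = 4 ^ m" by (simp add: power2_eq_square flip: power_mult_distrib)
      ultimately show "(4 :: real) ^ m \<le> 4 * (real p)\<^sup>2" by (simp add: power_mult_distrib)
    qed (use m in auto)
    also have "\<dots> = 2 * n / (m * J\<^sup>2)" using p0 J m by (simp add: power_mult_distrib)
    finally show ?thesis .
  qed

  define D where "D = {x :: int. \<exists>j\<in>{- int J..int J}. b / 2 \<le> cmod (trig_sum T (x + j * int p))}"
  define U where "U = pmf_of_set {0..<int p}"
  have walk_D: "1 - 4 * (\<sigma> - 1) - 2 * n / (m * J\<^sup>2) \<le> measure_pmf.prob (map_pmf (\<lambda>x. x mod int p) M) D"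
  proof -
    have "x mod int p \<in> D" if "b / 2 \<le> cmod (trig_sum T x)" "\<bar>x\<bar> < int J * int p" for x
    proof -
      have eq: "x mod int p + (x div int p) * int p = x" by (simp add: mult.commute)
      have "x div int p \<in> {- int J..int J}"
      proof -
        have "x div int p \<le> (int J * int p) div int p" using that p0 by (intro zdiv_mono1) auto
        moreover have "(- int J * int p) div int p \<le> x div int p" using that p0 by (intro zdiv_mono1) auto
        moreover have "(- int J * int p) div int p = - int J" "(int J * int p) div int p = int J"
          using p0 by (subst nonzero_mult_div_cancel_right, auto)+
        ultimately show ?thesis by simp
      qed
      thus ?thesis unfolding D_def mem_Collect_eq using that(1) eq by (intro bexI[of _ "x div int p"]) simp_all
    qed
    hence "UNIV \<subseteq> (\<lambda>x. x mod int p) -` D \<union> ({x. cmod (trig_sum T x) < b / 2} \<union> {x. int J * int p \<le> \<bar>x\<bar>})"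
      by (auto simp: not_less not_le)
    hence "measure_pmf.prob M UNIV \<le> measure_pmf.prob M ((\<lambda>x. x mod int p) -` D \<union> ({x. cmod (trig_sum T x) < b / 2} \<union> {x. int J * int p \<le> \<bar>x\<bar>}))"
      by (intro measure_pmf.finite_measure_mono) auto
    also have "\<dots> \<le> measure_pmf.prob M ((\<lambda>x. x mod int p) -` D) +
      (measure_pmf.prob M {x. cmod (trig_sum T x) < b / 2} + measure_pmf.prob M {x. int J * int p \<le> \<bar>x\<bar>})"
      by (intro order_trans[OF measure_Un_le] add_left_mono measure_Un_le) auto
    finally show ?thesis using walk_far walk_large by simp
  qed
  have uniform_D: "measure_pmf.prob U D \<le> (2 * J + 1) * 8 / Q"
  proof -
    have neU: "finite (set_pmf U)" using p0 by (simp add: U_def)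
    have one: "measure_pmf.prob U {x. b / 2 \<le> cmod (trig_sum T (x + j * int p))} \<le> 8 / Q" for j
    proof -
      define V where "V = map_pmf (\<lambda>x. x + j * int p) U"
      have finV: "finite (set_pmf V)" using neU by (simp add: V_def)
      have "measure_pmf.expectation V (\<lambda>x. (cmod (trig_sum T x))\<^sup>2) \<le> card T + (real (card T))\<^sup>2 * (1 / R)"
      proof (rule second_moment_le[OF finV finT])
        fix \<theta>' \<phi> assume "\<theta>' \<in> T" "\<phi> \<in> T" "\<theta>' \<noteq> \<phi>"
        from offdiag[OF this] obtain i l where il: "i \<in> {1..R}" "l \<in> {1..R}" "i < l"
          and d: "\<theta>' - \<phi> = 2 * pi * (1 / 2 ^ (G * l) - 1 / 2 ^ (G * i)) \<or> \<theta>' - \<phi> = 2 * pi * - (1 / 2 ^ (G * l) - 1 / 2 ^ (G * i))"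
          by blast
        define x where "x = 1 / 2 ^ (G * l) - (1 / 2 ^ (G * i) :: real)"
        obtain y where y: "\<theta>' - \<phi> = 2 * pi * y" "\<bar>y\<bar> = \<bar>x\<bar>" using d unfolding x_def[symmetric] by (metis abs_minus_cancel)
        have "G * i + 1 \<le> G * l"
        proof -
          have "G * (i + 1) \<le> G * l" using il by (intro mult_left_mono) auto
          thus ?thesis using G by (simp add: distrib_left)
        qed
        hence "(2 :: real) ^ (G * i + 1) \<le> 2 ^ (G * l)" by (intro power_increasing) auto
        hence "1 / 2 ^ (G * l) \<le> (1 / 2 ^ (G * i + 1) :: real)" by (intro divide_left_mono) auto
        hence l1: "2 * (1 / 2 ^ (G * l)) \<le> (1 / 2 ^ (G * i) :: real)" by simp
        have "1 / 2 ^ (G * i) \<le> (1 / 2 ^ 1 :: real)"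
          using il G by (intro divide_left_mono power_increasing) auto
        hence l2: "1 / 2 ^ (G * i) \<le> (1 / 2 :: real)" by (simp only: power_one_right)
        have l3: "1 / 2 ^ (G * R) \<le> (1 / 2 ^ (G * l) :: real)"
          using Gj[OF il(2)] by (intro divide_left_mono power_increasing) auto
        have l4: "0 < (1 / 2 ^ (G * l) :: real)" "0 < (1 / 2 ^ (G * R) :: real)" by simp_all
        have ax: "1 / 2 ^ (G * R) \<le> \<bar>x\<bar>" "\<bar>x\<bar> \<le> 1 / 2" using l1 l2 l3 l4 unfolding x_def by linarith+
        have "cmod (char_fun V (\<theta>' - \<phi>)) \<le> 1 / (2 * p * \<bar>x\<bar>)"
          unfolding y(1) V_def U_def y(2)[symmetric] using p0 ax l4 y(2)
          by (intro cmod_char_fun_interval_le) linarith+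
        also have "\<dots> \<le> 1 / (2 ^ m * (1 / 2 ^ (G * R)))"
        proof -
          have "0 < \<bar>x\<bar>" using ax l4 by linarith
          thus ?thesis using ax pr p0 by (intro divide_left_mono mult_mono mult_pos_pos) auto
        qed
        also have "\<dots> \<le> 1 / R"
        proof -
          have "real R \<le> 2 ^ R" using of_nat_less_two_power[of R, where 'a = real] by simp
          also have "(2 :: real) ^ R \<le> 2 ^ (G * R)" using G by (intro power_increasing) auto
          finally have "real R * 2 ^ (G * R) \<le> 2 ^ (G * R) * 2 ^ (G * R)" by (intro mult_right_mono) auto
          also have "\<dots> = (2 :: real) ^ (2 * (G * R))" by (simp add: mult_2 power_add)
          also have "\<dots> \<le> 2 ^ m" using GR by (intro power_increasing) auto
          finally show ?thesis using R by (simp add: field_simps)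
        qed
        finally show "cmod (char_fun V (\<theta>' - \<phi>)) \<le> 1 / R" .
      qed simp
      also have "\<dots> = 2 * R" using R by (simp add: cardT power2_eq_square)
      finally have E: "measure_pmf.expectation V (\<lambda>x. (cmod (trig_sum T x))\<^sup>2) \<le> 2 * R" .
      have "measure_pmf.prob U {x. b / 2 \<le> cmod (trig_sum T (x + j * int p))} = measure_pmf.prob V {x. b / 2 \<le> cmod (trig_sum T x)}"
        by (simp add: V_def vimage_def)
      also have "\<dots> \<le> measure_pmf.prob V {x. (b / 2)\<^sup>2 \<le> (cmod (trig_sum T x))\<^sup>2}"
        using b0 by (intro measure_pmf.finite_measure_mono) (auto intro: power_mono)
      also have "\<dots> \<le> measure_pmf.expectation V (\<lambda>x. (cmod (trig_sum T x))\<^sup>2) / (b / 2)\<^sup>2"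
        using b0 by (intro prob_ge_le_expectation finV) auto
      also have "\<dots> \<le> 2 * R / (b / 2)\<^sup>2" by (intro divide_right_mono E) auto
      also have "\<dots> = 8 / Q" using R Q0 by (simp add: power_divide b2')
      finally show ?thesis .
    qed
    have "D = (\<Union>j\<in>{- int J..int J}. {x. b / 2 \<le> cmod (trig_sum T (x + j * int p))})"
      by (auto simp: D_def)
    hence "measure_pmf.prob U D \<le> (\<Sum>j\<in>{- int J..int J}. measure_pmf.prob U {x. b / 2 \<le> cmod (trig_sum T (x + j * int p))})"
      by (simp only:) (intro measure_pmf.finite_measure_subadditive_finite, auto)
    also have "\<dots> \<le> (\<Sum>j\<in>{- int J..int J}. 8 / Q)" by (intro sum_mono one)
    also have "\<dots> = (2 * J + 1) * 8 / Q" by simp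
    finally show ?thesis .
  qed
  show ?thesis
    using tv_dist_geI[of "map_pmf (\<lambda>x. x mod int p) M" D U] walk_D uniform_D
    unfolding M_def[symmetric] U_def[symmetric] s_def[symmetric] Q_def[symmetric] \<sigma>_def
    by linarith
qed

section \<open>The step set modulo a prime\<close>

lemma ell2_bounds:
  assumes "2 \<le> p"
  shows "p \<le> 2 ^ ell2 p" "2 ^ ell2 p < 2 * p"
proof -
  have c0: "0 \<le> \<lceil>log 2 (real p)\<rceil>" using assms by (simp add: zero_le_ceiling le_less_trans[of _ 0])
  hence e: "real (ell2 p) = of_int \<lceil>log 2 (real p)\<rceil>" by (simp add: ell2_def)
  have pw: "real p = 2 powr log 2 (real p)" using assms by simp
  have "2 powr log 2 (real p) \<le> 2 powr real (ell2 p)" unfolding e by (intro powr_mono) auto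
  hence "real p \<le> 2 ^ ell2 p" using pw by (simp add: powr_realpow)
  thus "p \<le> 2 ^ ell2 p" by (metis of_nat_le_iff of_nat_numeral of_nat_power)
  have "real (ell2 p) < log 2 (real p) + 1" unfolding e by linarith
  hence "2 powr real (ell2 p) < 2 powr (log 2 (real p) + 1)" by (intro powr_less_mono) auto
  also have "\<dots> = 2 * real p" using pw by (simp add: powr_add)
  finally have "2 ^ ell2 p < 2 * real p" by (simp add: powr_realpow)
  thus "2 ^ ell2 p < 2 * p" by (metis of_nat_less_iff of_nat_mult of_nat_numeral of_nat_power)
qed

lemma filterlim_ell2: "filterlim ell2 at_top primes_at_top"
proof -
  have "\<forall>\<^sub>F p in at_top. Z \<le> ell2 p" for Z
    using eventually_ge_at_top[of "max 2 (2 ^ Z)"]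
  proof eventually_elim
    case (elim p)
    have "2 ^ Z \<le> p" using elim by simp
    also have "p \<le> 2 ^ ell2 p" using ell2_bounds(1)[of p] elim by simp
    finally show ?case by simp
  qed
  hence "filterlim ell2 at_top at_top" by (simp add: filterlim_at_top)
  thus ?thesis unfolding primes_at_top_def by (rule filterlim_mono) auto
qed

lemma dyadic_steps_abs_le: "x \<in> dyadic_steps m \<Longrightarrow> \<bar>x\<bar> \<le> 2 ^ (m - 1)"
proof -
  have "(2::int) ^ i \<le> 2 ^ (m - 1)" if "i < m" for i using that by (intro power_increasing) auto
  thus "x \<in> dyadic_steps m \<Longrightarrow> \<bar>x\<bar> \<le> 2 ^ (m - 1)" by (auto simp: dyadic_steps_def)
qed

lemma dyadic_steps_odd: "x \<in> dyadic_steps m \<Longrightarrow> odd x \<Longrightarrow> \<bar>x\<bar> = 1"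
  by (auto simp: dyadic_steps_def)

text \<open>
  A coincidence modulo \<open>p\<close> would be an equation \<open>x = y + p\<close>. As \<open>p\<close> is odd, one of \<open>x\<close> and \<open>y\<close> is odd,
  hence \<open>\<plusminus> 1\<close>, and the size of the other one leaves only \<open>p = 2^(m - 1) + 1\<close>.
\<close>
lemma inj_on_mod_dyadic_steps:
  assumes p: "odd p" "2 ^ (m - 1) < p" "p \<noteq> 2 ^ (m - 1) + 1"
  shows "inj_on (\<lambda>x. x mod p) (dyadic_steps m)"
proof (rule inj_onI)
  have no: "x \<noteq> y + p" if xy: "x \<in> dyadic_steps m" "y \<in> dyadic_steps m" for x y
  proof
    assume "x = y + p"
    hence "odd x \<or> odd y" using p by auto
    hence "\<bar>x\<bar> = 1 \<or> \<bar>y\<bar> = 1" using dyadic_steps_odd xy by blast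
    hence "p \<le> 2 ^ (m - 1) + 1"
      using dyadic_steps_abs_le[OF xy(1)] dyadic_steps_abs_le[OF xy(2)] \<open>x = y + p\<close> by linarith
    thus False using p by linarith
  qed
  fix x y assume xy: "x \<in> dyadic_steps m" "y \<in> dyadic_steps m" and eq: "x mod p = y mod p"
  from eq have "p dvd x - y" by (simp add: mod_eq_dvd_iff)
  then obtain k where k: "x - y = p * k" by (elim dvdE)
  have p0: "0 < p" using p(2) by (rule le_less_trans[rotated]) simp
  have "p * \<bar>k\<bar> = \<bar>x - y\<bar>" using k p0 by (simp add: abs_mult)
  also have "\<dots> < p * 2" using dyadic_steps_abs_le[OF xy(1)] dyadic_steps_abs_le[OF xy(2)] p(2) by linarith
  finally have "\<bar>k\<bar> < 2" using p0 by simp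
  hence "k = 0 \<or> k = 1 \<or> k = -1" by auto
  thus "x = y" using k no[OF xy] no[OF xy(2,1)] by auto
qed

text \<open>
  If \<open>p = 2^k + 1\<close> with \<open>k = ell2 p - 1\<close>, then \<open>2^k\<close> and \<open>- (2^k)\<close> are congruent to \<open>-1\<close> and \<open>1\<close>, and
  dropping the last power of two does not change the step set.
\<close>
lemma power2_set_dyadic:
  fixes p :: nat
  assumes p: "odd p" "3 \<le> p"
  obtains m where "m \<le> ell2 p" "ell2 p \<le> m + 1" "power2_set p = (\<lambda>x. x mod int p) ` dyadic_steps m"
    "inj_on (\<lambda>x. x mod int p) (dyadic_steps m)" "p < 2 ^ Suc m" "2 ^ m < 2 * p"
proof -
  have b: "p \<le> 2 ^ ell2 p" "2 ^ ell2 p < 2 * p" using ell2_bounds[of p] p by auto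
  have l2: "2 \<le> ell2 p"
  proof (rule ccontr)
    assume "\<not> 2 \<le> ell2 p"
    hence "(2::nat) ^ ell2 p \<le> 2 ^ 1" by (intro power_increasing) auto
    thus False using b p by simp
  qed
  then obtain k where k: "ell2 p = Suc k" "1 \<le> k" by (cases "ell2 p") auto
  have set: "power2_set p = (\<lambda>x. x mod int p) ` dyadic_steps (ell2 p)"
    by (auto simp: power2_set_def dyadic_steps_def image_Un image_image)
  have kp: "2 ^ k < p" using b(2) k by simp
  show ?thesis
  proof (cases "p = 2 ^ k + 1")
    case False
    have ip: "2 ^ (ell2 p - 1) < int p" using kp k by (metis diff_Suc_1 of_nat_less_iff of_nat_numeral of_nat_power)
    have "int p \<noteq> int (2 ^ k + 1)" using False by (simp only: of_nat_eq_iff not_False_eq_True)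
    hence ne: "int p \<noteq> 2 ^ (ell2 p - 1) + 1" using k by simp
    have "p < 2 ^ Suc (ell2 p)" using b by simp
    thus ?thesis using that[of "ell2 p"] set b inj_on_mod_dyadic_steps[OF _ ip ne] p by simp
  next
    case True
    have pk: "int p = 2 ^ k + 1" using True by simp
    have m1: "2 ^ k mod int p = (- 1) mod int p" "- (2 ^ k) mod int p = 1 mod int p"
    proof -
      have "2 ^ k - (- 1) = int p" "- (2 ^ k) - 1 = - int p" using pk by simp_all
      thus "2 ^ k mod int p = (- 1) mod int p" "- (2 ^ k) mod int p = 1 mod int p"
        unfolding mod_eq_dvd_iff by (simp_all only: dvd_refl dvd_minus_iff)
    qed
    have "dyadic_steps (Suc k) = dyadic_steps k \<union> {2 ^ k, - (2 ^ k)}"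
      by (auto simp: dyadic_steps_def lessThan_Suc)
    moreover have "1 \<in> dyadic_steps k" "- 1 \<in> dyadic_steps k"
      using k by (auto simp: dyadic_steps_def image_iff intro!: bexI[of _ 0])
    ultimately have "(\<lambda>x. x mod int p) ` dyadic_steps (ell2 p) = (\<lambda>x. x mod int p) ` dyadic_steps k"
      using k m1 by (auto simp: image_iff)
    hence s: "power2_set p = (\<lambda>x. x mod int p) ` dyadic_steps k" using set by simp
    have lt: "(2 :: int) ^ (k - 1) < 2 ^ k" using k by (intro power_strict_increasing) auto
    have "inj_on (\<lambda>x. x mod int p) (dyadic_steps k)"
      by (rule inj_on_mod_dyadic_steps) (use p pk lt in auto)
    moreover have "p < 2 ^ Suc k" using b k p by (cases "p = 2 ^ Suc k") auto
    ultimately show ?thesis using that[of k] s k kp by simp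
  qed
qed

section \<open>Above and below the critical time\<close>

text \<open>
  The first term covers the negative values of the characteristic function.
\<close>
lemma dyadic_char_power_le:
  assumes "0 < m"
  shows "dyadic_char m x ^ (2 * n) \<le> (9 / 16) ^ n + exp (- (4 * real n / (2 * real m + 1)) * (\<Sum>i<m. cost (2 ^ i * x)))"
proof -
  define S where "S = (\<Sum>i<m. cost (2 ^ i * x))"
  have dc: "dyadic_char m x = 1 - 2 / (2 * m + 1) * S" by (simp add: dyadic_char_def S_def)
  show ?thesis
  proof (cases "0 \<le> dyadic_char m x")
    case True
    have "dyadic_char m x \<le> exp (- (2 / (2 * m + 1) * S))"
      unfolding dc using exp_ge_add_one_self[of "- (2 / (2 * m + 1) * S)"] by linarith
    hence "dyadic_char m x ^ (2 * n) \<le> exp (- (2 / (2 * m + 1) * S)) ^ (2 * n)"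
      using True by (intro power_mono)
    also have "\<dots> = exp (- (4 * real n / (2 * real m + 1)) * S)"
      by (simp add: exp_of_nat_mult[symmetric] add.commute)
    finally have "dyadic_char m x ^ (2 * n) \<le> exp (- (4 * real n / (2 * real m + 1)) * S)" .
    thus ?thesis unfolding S_def[symmetric] by (intro add_increasing) auto
  next
    case False
    have "(dyadic_char m x)\<^sup>2 \<le> 9 / 16"
    proof -
      have "\<bar>dyadic_char m x\<bar> \<le> 3 / 4" using dyadic_char_ge[OF assms, of x] False by linarith
      hence "\<bar>dyadic_char m x\<bar>\<^sup>2 \<le> (3 / 4)\<^sup>2" by (intro power_mono) auto
      thus ?thesis by (simp add: power2_eq_square)
    qed
    hence "((dyadic_char m x)\<^sup>2) ^ n \<le> (9 / 16) ^ n" by (intro power_mono) auto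
    thus ?thesis by (simp add: power_mult add_increasing2)
  qed
qed

lemma sum_symmetric_le:
  fixes h :: "nat \<Rightarrow> real"
  assumes "odd p" "\<And>\<xi>. \<xi> < p \<Longrightarrow> h (p - \<xi>) = h \<xi>" "\<And>\<xi>. 0 \<le> h \<xi>"
  shows "(\<Sum>\<xi>=1..<p. h \<xi>) \<le> 2 * (\<Sum>\<xi>=1..(p - 1) div 2. h \<xi>)"
proof -
  let ?H = "{1..(p - 1) div 2}"
  have "{1..<p} \<subseteq> ?H \<union> (\<lambda>\<xi>. p - \<xi>) ` ?H"
  proof
    fix \<xi> assume x: "\<xi> \<in> {1..<p}"
    show "\<xi> \<in> ?H \<union> (\<lambda>\<xi>. p - \<xi>) ` ?H"
    proof (cases "\<xi> \<le> (p - 1) div 2")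
      case False
      hence "p - \<xi> \<in> ?H" using x \<open>odd p\<close> by (auto elim!: oddE)
      moreover have "\<xi> = p - (p - \<xi>)" using x by simp
      ultimately show ?thesis by blast
    qed (use x in auto)
  qed
  hence "(\<Sum>\<xi>=1..<p. h \<xi>) \<le> sum h (?H \<union> (\<lambda>\<xi>. p - \<xi>) ` ?H)"
    using assms(3) by (intro sum_mono2) auto
  also have "\<dots> \<le> sum h ?H + sum h ((\<lambda>\<xi>. p - \<xi>) ` ?H)"
  proof -
    have "0 \<le> sum h (?H \<inter> (\<lambda>\<xi>. p - \<xi>) ` ?H)" using assms(3) by (intro sum_nonneg)
    thus ?thesis by (subst sum_Un) auto
  qed
  also have "sum h ((\<lambda>\<xi>. p - \<xi>) ` ?H) = (\<Sum>\<xi>\<in>?H. h (p - \<xi>))"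
    by (subst sum.reindex) (auto intro!: inj_onI)
  also have "\<dots> = sum h ?H"
    using \<open>odd p\<close> by (intro sum.cong refl assms(2)) (auto elim!: oddE)
  finally show ?thesis by simp
qed

text \<open>
  Since \<open>n \<ge> 2 m\<close> for large \<open>m\<close> and \<open>p < 2^(m + 1)\<close>, the \<open>p\<close> terms \<open>(9/16)^n\<close> are negligible and the claim reduces
  to \<open>character_sum_small\<close> with an exponent \<open>\<alpha>\<close> between \<open>1 / c0\<close> and \<open>(1 + \<epsilon>) / c0\<close>.
\<close>
lemma tv_upper_regime:
  fixes \<epsilon> \<eta> :: real
  assumes \<epsilon>: "0 < \<epsilon>" and \<eta>: "0 < \<eta>"
  shows "\<forall>\<^sub>F m in at_top. \<forall>p n :: nat. odd p \<and> p < 2 ^ Suc m \<and> (1 + \<epsilon>) * (m * ln m / (2 * c0)) \<le> n \<longrightarrow>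
    tv_dist (map_pmf (\<lambda>x. x mod int p) (int_walk (dyadic_steps m) n)) (pmf_of_set {0..<int p}) \<le> \<eta>"
proof -
  have c0: "2 \<le> c0" by (rule c0_ge_2)
  define \<alpha> where "\<alpha> = (1 + \<epsilon> / 2) / c0"
  have "1 / c0 < \<alpha>" using c0 \<epsilon> by (simp add: \<alpha>_def divide_strict_right_mono)
  hence ev1: "\<forall>\<^sub>F m in at_top. \<forall>p::nat. odd p \<and> p < 2 ^ Suc m \<longrightarrow>
    (\<Sum>\<xi>=1..(p - 1) div 2. exp (- (\<alpha> * ln m) * (\<Sum>i<m. cost (2 ^ i * (real \<xi> / real p))))) \<le> \<eta>\<^sup>2 / 4"
    using \<eta> by (intro character_sum_small) auto
  have "(\<lambda>m::nat. 4 * (1 + \<epsilon>) * real m / (2 * real m + 1)) \<longlonglongrightarrow> 2 * (1 + \<epsilon>)" by real_asymp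
  hence ev2: "\<forall>\<^sub>F m :: nat in at_top. 2 * (1 + \<epsilon> / 2) < 4 * (1 + \<epsilon>) * real m / (2 * real m + 1)"
    using \<epsilon> by (intro order_tendstoD) auto
  have "(\<lambda>m::nat. 2 * (162 / 256 :: real) ^ m) \<longlonglongrightarrow> 0" by real_asymp
  from order_tendstoD(2)[OF this, of "\<eta>\<^sup>2 / 2"]
  have ev3: "\<forall>\<^sub>F m::nat in at_top. 2 * (162 / 256 :: real) ^ m < \<eta>\<^sup>2 / 2"
    using \<eta> by simp
  have "filterlim (\<lambda>m::nat. ln m / (2 * c0)) at_top at_top" using c0 by real_asymp
  hence ev4: "\<forall>\<^sub>F m::nat in at_top. 2 \<le> ln m / (2 * c0)" by (simp add: filterlim_at_top)
  show ?thesis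
    using ev1 ev2 ev3 ev4 eventually_ge_at_top[of 1]
  proof eventually_elim
    case (elim m)
    have m: "0 < m" using elim by simp
    have lnm: "0 \<le> ln m" using elim by simp
    show ?case
    proof (intro allI impI)
      fix p n :: nat
      assume *: "odd p \<and> p < 2 ^ Suc m \<and> (1 + \<epsilon>) * (m * ln m / (2 * c0)) \<le> n"
      hence p0: "0 < p" by (auto intro: Nat.gr0I)
      have pm: "real p < 2 * 2 ^ m" using * by (metis of_nat_less_iff of_nat_numeral of_nat_power power_Suc)
      define S where "S \<xi> = (\<Sum>i<m. cost (2 ^ i * (real \<xi> / real p)))" for \<xi> :: nat
      have S0: "0 \<le> S \<xi>" for \<xi> unfolding S_def by (intro sum_nonneg) auto
      have Ssym: "S (p - \<xi>) = S \<xi>" if "\<xi> < p" for \<xi>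
      proof -
        have "cost (2 ^ i * (real (p - \<xi>) / p)) = cost (2 ^ i * (real \<xi> / p))" for i
        proof -
          have "2 ^ i * (real (p - \<xi>) / p) = - (2 ^ i * (real \<xi> / p)) + of_int (2 ^ i)"
            using that p0 by (simp add: of_nat_diff field_simps)
          thus ?thesis by (simp only: cost_add_int cost_minus)
        qed
        thus ?thesis by (simp add: S_def)
      qed
      have n2: "2 * m \<le> n"
      proof -
        define A where "A = m * (ln m / (2 * c0))"
        have "2 * real m \<le> A" using mult_left_mono[of 2 "ln m / (2 * c0)" "real m"] elim
          by (simp only: A_def mult.commute of_nat_0_le_iff)
        moreover have "0 \<le> \<epsilon> * A" unfolding A_def
          using lnm c0 \<epsilon> by (intro mult_nonneg_nonneg divide_nonneg_nonneg) auto
        moreover have "A + \<epsilon> * A \<le> n" using * by (simp add: A_def algebra_simps add_divide_distrib)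
        ultimately have "real (2 * m) \<le> real n" by simp
        thus ?thesis by (simp only: of_nat_le_iff)
      qed
      have \<beta>: "\<alpha> * ln m \<le> 4 * real n / (2 * real m + 1)"
      proof -
        have "\<alpha> * ln m = 2 * (1 + \<epsilon> / 2) * (ln m / (2 * c0))" using c0 by (simp add: \<alpha>_def field_simps)
        also have "\<dots> \<le> 4 * (1 + \<epsilon>) * real m / (2 * real m + 1) * (ln m / (2 * c0))"
          using elim lnm c0 by (intro mult_right_mono) auto
        also have "\<dots> = 4 * ((1 + \<epsilon>) * (m * ln m / (2 * c0))) / (2 * real m + 1)"
          using c0 by (simp add: divide_simps) (simp add: algebra_simps)?
        also have "\<dots> \<le> 4 * real n / (2 * real m + 1)" using * by (intro divide_right_mono mult_left_mono) auto
        finally show ?thesis .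
      qed
      have "(\<Sum>\<xi>=1..<p. (cmod (char_fun (int_walk (dyadic_steps m) n) (2 * pi * (real \<xi> / p))))\<^sup>2)
          = (\<Sum>\<xi>=1..<p. dyadic_char m (real \<xi> / p) ^ (2 * n))"
        unfolding char_fun_dyadic_walk norm_of_real power2_abs by (simp add: mult.commute flip: power_mult)
      also have "\<dots> \<le> (\<Sum>\<xi>=1..<p. (9 / 16) ^ n + exp (- (\<alpha> * ln m) * S \<xi>))"
      proof (rule sum_mono)
        fix \<xi>
        have "dyadic_char m (real \<xi> / p) ^ (2 * n) \<le> (9 / 16) ^ n + exp (- (4 * real n / (2 * real m + 1)) * S \<xi>)"
          unfolding S_def by (rule dyadic_char_power_le[OF m])
        also have "exp (- (4 * real n / (2 * real m + 1)) * S \<xi>) \<le> exp (- (\<alpha> * ln m) * S \<xi>)"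
          using mult_right_mono[OF \<beta> S0[of \<xi>]] by simp
        finally show "dyadic_char m (real \<xi> / p) ^ (2 * n) \<le> (9 / 16) ^ n + exp (- (\<alpha> * ln m) * S \<xi>)" by simp
      qed
      also have "\<dots> = real (p - 1) * (9 / 16) ^ n + (\<Sum>\<xi>=1..<p. exp (- (\<alpha> * ln m) * S \<xi>))"
        by (simp add: sum.distrib)
      also have "\<dots> \<le> \<eta>\<^sup>2 / 2 + 2 * (\<eta>\<^sup>2 / 4)"
      proof (rule add_mono)
        have "real (p - 1) * (9 / 16) ^ n \<le> (2 * 2 ^ m) * (9 / 16) ^ (2 * m)"
          using pm n2 by (intro mult_mono power_decreasing) auto
        also have "\<dots> = 2 * (162 / 256) ^ m"
          by (simp add: power_mult power2_eq_square flip: power_mult_distrib)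
        finally show "real (p - 1) * (9 / 16) ^ n \<le> \<eta>\<^sup>2 / 2" using elim by simp
        have "(\<Sum>\<xi>=1..<p. exp (- (\<alpha> * ln m) * S \<xi>)) \<le> 2 * (\<Sum>\<xi>=1..(p - 1) div 2. exp (- (\<alpha> * ln m) * S \<xi>))"
          using * Ssym by (intro sum_symmetric_le) auto
        also have "\<dots> \<le> 2 * (\<eta>\<^sup>2 / 4)" unfolding S_def using elim * by (intro mult_left_mono) auto
        finally show "(\<Sum>\<xi>=1..<p. exp (- (\<alpha> * ln m) * S \<xi>)) \<le> 2 * (\<eta>\<^sup>2 / 4)" .
      qed
      finally have "(\<Sum>\<xi>=1..<p. (cmod (char_fun (int_walk (dyadic_steps m) n) (2 * pi * (real \<xi> / p))))\<^sup>2) \<le> \<eta>\<^sup>2" by simp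
      hence "sqrt (\<Sum>\<xi>=1..<p. (cmod (char_fun (int_walk (dyadic_steps m) n) (2 * pi * (real \<xi> / p))))\<^sup>2) \<le> \<eta>"
        using \<eta> by (intro real_le_lsqrt) auto
      thus "tv_dist (map_pmf (\<lambda>x. x mod int p) (int_walk (dyadic_steps m) n)) (pmf_of_set {0..<int p}) \<le> \<eta>"
        using tv_dist_le_char_fun[OF p0, of "int_walk (dyadic_steps m) n"] by simp
    qed
  qed
qed

text \<open>
  The parameters of \<open>tv_lower_bound\<close> are a gap \<open>G \<approx> ln m\<close>, which makes the correlations \<open>1 / 2^G\<close> a
  negative power of \<open>m\<close>, and \<open>J \<approx> m^(\<epsilon>/4)\<close> lifts. Then \<open>R q^(2 n)\<close> is at least of order
  \<open>m^(3 \<epsilon> / 4)\<close> up to a logarithm, which beats \<open>J\<close>.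
\<close>
lemma tv_lower_regime:
  fixes \<epsilon> \<eta> :: real
  assumes \<epsilon>: "0 < \<epsilon>" "\<epsilon> < 1" and \<eta>: "0 < \<eta>"
  shows "\<forall>\<^sub>F m in at_top. \<forall>p n :: nat. 2 ^ m < 2 * p \<and> n \<le> (1 - \<epsilon>) * (m * ln m / (2 * c0)) \<longrightarrow>
    1 - \<eta> < tv_dist (map_pmf (\<lambda>x. x mod int p) (int_walk (dyadic_steps m) n)) (pmf_of_set {0..<int p})"
proof -
  have c0: "2 \<le> c0" by (rule c0_ge_2)
  \<comment> \<open>\<open>Q m\<close> is a lower bound for \<open>R q^(2 n)\<close>.\<close>
  define Q where "Q m = (real m / (2 * (ln m + 1)) - 1) * real m powr (3 / 4 * \<epsilon> - 1)" for m :: nat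
  define err where "err m = 4 * (1 / Q m + exp (12 * ln m * real m powr (- ln 2)) - 1)
     + ln m / 2 * real m powr (- \<epsilon> / 2) + (2 * (real m powr (\<epsilon> / 4) + 1) + 1) * 8 / Q m" for m :: nat
  have "err \<longlonglongrightarrow> 0"
    unfolding err_def Q_def using \<epsilon> by real_asymp
  hence ev1: "\<forall>\<^sub>F m in at_top. err m < \<eta>" using \<eta> by (intro order_tendstoD(2))
  have "filterlim (\<lambda>m::nat. real m / (2 * (ln m + 1))) at_top at_top" by real_asymp
  hence ev2: "\<forall>\<^sub>F m::nat in at_top. 2 \<le> real m / (2 * (ln m + 1))" by (simp add: filterlim_at_top)
  have "(\<lambda>m::nat. c0 / real m) \<longlonglongrightarrow> 0" by real_asymp
  from order_tendstoD(2)[OF this, of "\<epsilon> / 8"]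
  have ev3: "\<forall>\<^sub>F m::nat in at_top. c0 / m < \<epsilon> / 8" using \<epsilon> by simp
  show ?thesis
    using ev1 ev2 ev3 eventually_ge_at_top[of 2]
  proof eventually_elim
    case (elim m)
    have m: "2 \<le> m" using elim by simp
    have lnm: "0 < ln m" using m by simp
    define G where "G = nat \<lceil>ln (real m)\<rceil>"
    define R where "R = m div (2 * G)"
    define J where "J = nat \<lceil>real m powr (\<epsilon> / 4)\<rceil>"
    define x where "x = c0 / m"
    define q where "q = 1 - 2 * c0 / (2 * m + 1)"
    have G: "ln m \<le> G" "G \<le> ln m + 1" "0 < G"
      using lnm by (auto simp: G_def)
    have J: "real m powr (\<epsilon> / 4) \<le> J" "J \<le> real m powr (\<epsilon> / 4) + 1" "0 < J"
      using m by (auto simp: J_def)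
    have x: "0 < x" "x \<le> \<epsilon> / 8" using elim c0 m by (simp_all add: x_def)
    hence x8: "x \<le> 1 / 8" using \<epsilon> by linarith
    have qx: "1 - x \<le> q"
    proof -
      have "2 * c0 / (2 * m + 1) \<le> 2 * c0 / (2 * m)" using c0 m by (intro divide_left_mono) auto
      also have "\<dots> = x" using m by (simp add: x_def)
      finally show ?thesis by (simp add: q_def)
    qed
    have GR: "2 * (G * R) \<le> m"
      unfolding R_def by (metis div_times_less_eq_dividend mult.assoc mult.commute)
    have R: "real m / (2 * (ln m + 1)) - 1 \<le> R"
    proof -
      have "real m / (2 * (ln m + 1)) \<le> real m / (2 * G)" using G lnm by (intro divide_left_mono) auto
      also have "\<dots> \<le> real (m div (2 * G)) + 1"
      proof -
        have "m < 2 * G + m div (2 * G) * (2 * G)" by (rule dividend_less_div_times) (use G in simp)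
        hence "real m \<le> real (2 * G + m div (2 * G) * (2 * G))" by (simp only: of_nat_le_iff less_imp_le)
        hence "real m \<le> (real (m div (2 * G)) + 1) * (2 * real G)"
          by (simp only: of_nat_mult of_nat_add of_nat_numeral distrib_right mult_1_left add.commute)
        thus ?thesis using G by (simp add: divide_le_eq)
      qed
      finally show ?thesis by (simp add: R_def)
    qed
    have R0: "0 < R" using R elim by simp
    have q0: "0 < q" "1 / 2 \<le> q\<^sup>2"
    proof -
      have "7 / 8 \<le> q" using qx x x8 by linarith
      moreover from this have "(7 / 8)\<^sup>2 \<le> q\<^sup>2" by (intro power_mono) auto
      ultimately show "0 < q" "1 / 2 \<le> q\<^sup>2" by (auto simp: power2_eq_square)
    qed
    have u: "3 / 4 \<le> 1 - 2 / (2 * m + 1) * (2 * c0 - 6 * pi / 2 ^ G)"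
    proof -
      have "2 / (2 * m + 1) * (2 * c0 - 6 * pi / 2 ^ G) \<le> 2 / (2 * m + 1) * (2 * c0)"
        by (intro mult_left_mono) auto
      also have "\<dots> = 2 * (1 - q)" by (simp add: q_def)
      also have "\<dots> \<le> 2 * (1 / 8)" using qx x8 by (intro mult_left_mono) simp_all
      finally show ?thesis by linarith
    qed
    show ?case
    proof (intro allI impI)
      fix p n :: nat
      assume *: "2 ^ m < 2 * p \<and> n \<le> (1 - \<epsilon>) * (m * ln m / (2 * c0))"
      have Qm: "Q m \<le> R * q ^ (2 * n)"
      proof -
        have "- x - 2 * x\<^sup>2 \<le> ln (1 - x)" using x x8 by (intro ln_one_minus_pos_lower_bound) auto
        also have "\<dots> \<le> ln q" using qx x x8 by simp
        finally have "- x * (1 + 2 * x) \<le> ln q" by (simp add: power2_eq_square algebra_simps)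
        moreover have "x * (1 + 2 * x) \<le> x * (1 + \<epsilon> / 4)" using x by (intro mult_left_mono) auto
        ultimately have lq: "- (x * (1 + \<epsilon> / 4)) \<le> ln q" by simp
        have "2 * real n \<le> 2 * ((1 - \<epsilon>) * (m * ln m / (2 * c0)))" using * by linarith
        hence "2 * real n * x \<le> 2 * ((1 - \<epsilon>) * (m * ln m / (2 * c0))) * x" using x by (intro mult_right_mono) auto
        also have "\<dots> = (1 - \<epsilon>) * ln m" using m c0 by (simp add: x_def)
        finally have "(2 * n * x) * (1 + \<epsilon> / 4) \<le> ((1 - \<epsilon>) * ln m) * (1 + \<epsilon> / 4)"
          using \<epsilon> by (intro mult_right_mono) auto
        also have "\<dots> = (1 - 3 / 4 * \<epsilon> - \<epsilon>\<^sup>2 / 4) * ln m" by (simp add: power2_eq_square algebra_simps)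
        also have "\<dots> \<le> (1 - 3 / 4 * \<epsilon>) * ln m" using lnm by (intro mult_right_mono) auto
        finally have a: "(3 / 4 * \<epsilon> - 1) * ln m \<le> 2 * n * (- (x * (1 + \<epsilon> / 4)))" by (simp add: algebra_simps)
        also have "\<dots> \<le> 2 * n * ln q" using lq by (intro mult_left_mono) auto
        finally have "exp ((3 / 4 * \<epsilon> - 1) * ln m) \<le> exp (real (2 * n) * ln q)" by simp
        also have "\<dots> = q ^ (2 * n)" using q0 by (simp only: exp_of_nat_mult exp_ln)
        finally have "real m powr (3 / 4 * \<epsilon> - 1) \<le> q ^ (2 * n)" using m by (simp add: powr_def)
        thus ?thesis unfolding Q_def using R elim by (intro mult_mono) auto
      qed
      have Q0: "0 < Q m" using elim m by (simp add: Q_def)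
      have Qi: "1 / (R * q ^ (2 * n)) \<le> 1 / Q m" using Qm Q0 R0 q0 by (intro divide_left_mono mult_pos_pos) auto
      have nm: "n / m \<le> ln m / 4"
      proof -
        have "n / m \<le> (1 - \<epsilon>) * (m * ln m / (2 * c0)) / m" using * by (intro divide_right_mono) auto
        also have "\<dots> = (1 - \<epsilon>) * (ln m / (2 * c0))" using m by simp
        also have "\<dots> \<le> 1 * (ln m / (2 * 2))"
          using \<epsilon> lnm c0 by (intro mult_mono divide_left_mono) auto
        finally show ?thesis by simp
      qed
      have e: "48 * n / (2 ^ G * m) \<le> 12 * ln m * real m powr (- ln 2)"
      proof -
        have "real m powr ln 2 = 2 powr ln m" using m by (simp add: powr_def mult.commute)
        also have "\<dots> \<le> 2 powr G" using G by (intro powr_mono) auto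
        also have "\<dots> = 2 ^ G" by (simp add: powr_realpow)
        finally have g: "1 / 2 ^ G \<le> 1 / real m powr ln 2" using m by (intro divide_left_mono) auto
        have "48 * n / (2 ^ G * m) = 48 * (n / m) * (1 / 2 ^ G)" by simp
        also have "\<dots> \<le> 48 * (ln m / 4) * (1 / real m powr ln 2)"
          using nm g lnm by (intro mult_mono) auto
        also have "\<dots> = 12 * ln m * real m powr (- ln 2)" unfolding powr_minus_divide by simp
        finally show ?thesis .
      qed
      have j: "2 * n / (m * J\<^sup>2) \<le> ln m / 2 * real m powr (- \<epsilon> / 2)"
      proof -
        have "(real m powr (\<epsilon> / 4))\<^sup>2 \<le> (real J)\<^sup>2" using J by (intro power_mono) auto
        moreover have "(real m powr (\<epsilon> / 4))\<^sup>2 = real m powr (\<epsilon> / 2)"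
          by (simp add: power2_eq_square flip: powr_add)
        ultimately have g: "1 / (real J)\<^sup>2 \<le> 1 / real m powr (\<epsilon> / 2)" using m J by (intro divide_left_mono) auto
        have "2 * n / (m * J\<^sup>2) = 2 * (n / m) * (1 / (real J)\<^sup>2)" by simp
        also have "\<dots> \<le> 2 * (ln m / 4) * (1 / real m powr (\<epsilon> / 2))"
          using nm g lnm by (intro mult_mono) auto
        also have "\<dots> = ln m / 2 * real m powr (- (\<epsilon> / 2))" unfolding powr_minus_divide by simp
        finally show ?thesis by (simp only: minus_divide_left)
      qed
      have l: "(2 * J + 1) * 8 / (R * q ^ (2 * n)) \<le> (2 * (real m powr (\<epsilon> / 4) + 1) + 1) * 8 / Q m"
        using J Qm Q0 by (intro frac_le mult_right_mono) auto
      have "exp (48 * n / (2 ^ G * m)) \<le> exp (12 * ln m * real m powr (- ln 2))" using e by simp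
      hence "1 - err m \<le> 1 - 4 * (1 / (R * q ^ (2 * n)) + exp (48 * n / (2 ^ G * m)) - 1) - 2 * n / (m * J\<^sup>2)
          - (2 * J + 1) * 8 / (R * q ^ (2 * n))"
        unfolding err_def using Qi j l by argo
      also have "\<dots> \<le> tv_dist (map_pmf (\<lambda>x. x mod int p) (int_walk (dyadic_steps m) n)) (pmf_of_set {0..<int p})"
        unfolding q_def using m G R0 GR * J q0 u by (intro tv_lower_bound) (auto simp: q_def)
      finally show "1 - \<eta> < tv_dist (map_pmf (\<lambda>x. x mod int p) (int_walk (dyadic_steps m) n)) (pmf_of_set {0..<int p})"
        using elim by linarith
    qed
  qed
qed

section \<open>Cut-off\<close>

definition cutoff_time :: "nat \<Rightarrow> real" where
  "cutoff_time l = real l * ln (real l) / (2 * c0)"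

lemma cutoff_time_mono: "1 \<le> k \<Longrightarrow> k \<le> l \<Longrightarrow> cutoff_time k \<le> cutoff_time l"
  unfolding cutoff_time_def using c0_ge_2 by (intro divide_right_mono mult_mono) auto

lemma cutoff_time_pred: "(\<lambda>l. cutoff_time (l - 1) / cutoff_time l) \<longlonglongrightarrow> 1"
proof -
  have "(\<lambda>l::nat. (real l - 1) * ln (real l - 1) / (real l * ln (real l))) \<longlonglongrightarrow> 1" by real_asymp
  thus ?thesis
  proof (rule Lim_transform_eventually)
    show "\<forall>\<^sub>F l in sequentially. (real l - 1) * ln (real l - 1) / (real l * ln (real l)) = cutoff_time (l - 1) / cutoff_time l"
      using eventually_ge_at_top[of 1]
    proof eventually_elim
      case (elim l)
      thus ?case using c0_ge_2 by (simp add: cutoff_time_def of_nat_diff)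
    qed
  qed
qed

lemma filterlim_cutoff_time: "filterlim cutoff_time at_top at_top"
proof -
  have "0 < c0" using c0_ge_2 by linarith
  thus ?thesis unfolding cutoff_time_def by real_asymp
qed

lemma eventually_primes_at_top: "eventually P at_top \<Longrightarrow> \<forall>\<^sub>F p in primes_at_top. prime p \<and> P p"
  unfolding primes_at_top_def eventually_inf_principal by (auto elim: eventually_mono)

text \<open>
  The lower bound uses that the infimum defining the mixing time is attained, which holds as soon as the
  upper bound provides an element of the set. Replacing \<open>m\<close> by \<open>ell2 p\<close> costs a factor tending to \<open>1\<close>.
\<close>
lemma mix_time_bounds:
  fixes \<epsilon> \<eta> :: real
  assumes \<epsilon>: "0 < \<epsilon>" "\<epsilon> < 1" and \<eta>: "0 < \<eta>" "\<eta> < 1"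
  shows "\<forall>\<^sub>F p in primes_at_top.
    (1 - \<epsilon>) * cutoff_time (ell2 p) \<le> mix_time (residue_ring (int p)) (power2_set p) \<eta> \<and>
    mix_time (residue_ring (int p)) (power2_set p) \<eta> \<le> (1 + \<epsilon>) * cutoff_time (ell2 p)"
proof -
  define \<delta> where "\<delta> = \<epsilon> / 2"
  have \<delta>: "0 < \<delta>" "\<delta> < 1" "\<delta> < \<epsilon>" using \<epsilon> by (auto simp: \<delta>_def)
  define tv where "tv m p n = tv_dist (map_pmf (\<lambda>x. x mod int p) (int_walk (dyadic_steps m) n)) (pmf_of_set {0..<int p})" for m p n :: nat
  have upper: "\<forall>\<^sub>F m in at_top. \<forall>p n :: nat. odd p \<and> p < 2 ^ Suc m \<and> (1 + \<delta>) * cutoff_time m \<le> n \<longrightarrow> tv m p n \<le> \<eta>"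
    unfolding tv_def cutoff_time_def using \<delta> \<eta> by (intro tv_upper_regime)
  have lower: "\<forall>\<^sub>F m in at_top. \<forall>p n :: nat. 2 ^ m < 2 * p \<and> n \<le> (1 - \<delta>) * cutoff_time m \<longrightarrow> 1 - (1 - \<eta>) < tv m p n"
    unfolding tv_def cutoff_time_def using \<delta> \<eta> by (intro tv_lower_regime) auto
  obtain M where M: "\<And>m. M \<le> m \<Longrightarrow>
      (\<forall>p n :: nat. odd p \<and> p < 2 ^ Suc m \<and> (1 + \<delta>) * cutoff_time m \<le> n \<longrightarrow> tv m p n \<le> \<eta>) \<and>
      (\<forall>p n :: nat. 2 ^ m < 2 * p \<and> n \<le> (1 - \<delta>) * cutoff_time m \<longrightarrow> 1 - (1 - \<eta>) < tv m p n)"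
    using eventually_conj[OF upper lower] unfolding eventually_at_top_linorder by blast
  have up: "tv m p n \<le> \<eta>"
    if "M \<le> m" "odd p" "p < 2 ^ Suc m" "(1 + \<delta>) * cutoff_time m \<le> real n" for m p n
    using M[OF that(1)] that by blast
  have lo: "\<eta> < tv m p n"
    if "M \<le> m" "2 ^ m < 2 * p" "real n \<le> (1 - \<delta>) * cutoff_time m" for m p n
    using M[OF that(1)] that by (metis diff_diff_eq2 add_diff_cancel_left')
  have "(1 - \<epsilon>) / (1 - \<delta>) < 1" using \<delta> \<epsilon> by simp
  hence ev1: "\<forall>\<^sub>F l in at_top. (1 - \<epsilon>) / (1 - \<delta>) < cutoff_time (l - 1) / cutoff_time l"
    using cutoff_time_pred by (rule order_tendstoD(1)[rotated])
  have ev2: "\<forall>\<^sub>F l in at_top. 1 / (\<epsilon> - \<delta>) \<le> cutoff_time l"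
    using filterlim_cutoff_time by (simp add: filterlim_at_top)
  have "\<forall>\<^sub>F l in at_top. M + 2 \<le> l \<and> (1 - \<epsilon>) / (1 - \<delta>) < cutoff_time (l - 1) / cutoff_time l \<and> 1 / (\<epsilon> - \<delta>) \<le> cutoff_time l"
    by (intro eventually_conj ev1 ev2 eventually_ge_at_top)
  from filterlim_ell2[unfolded filterlim_iff, rule_format, OF this]
    eventually_primes_at_top[OF eventually_ge_at_top[of 3]]
  show ?thesis
  proof eventually_elim
    case (elim p)
    define l where "l = ell2 p"
    have l: "M + 2 \<le> l" "(1 - \<epsilon>) / (1 - \<delta>) < cutoff_time (l - 1) / cutoff_time l" "1 / (\<epsilon> - \<delta>) \<le> cutoff_time l"
      using elim by (auto simp: l_def)
    have p: "odd p" "3 \<le> p" using elim prime_odd_nat[of p] by auto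
    obtain m where m: "m \<le> l" "l \<le> m + 1" "power2_set p = (\<lambda>x. x mod int p) ` dyadic_steps m"
      "inj_on (\<lambda>x. x mod int p) (dyadic_steps m)" "p < 2 ^ Suc m" "2 ^ m < 2 * p"
      using power2_set_dyadic[OF p] unfolding l_def by blast
    have Mm: "M \<le> m" using l m by linarith
    have c: "0 < cutoff_time l" using l \<delta> by (intro less_le_trans[OF _ l(3)]) simp
    have cm: "cutoff_time m \<le> cutoff_time l" "cutoff_time (l - 1) \<le> cutoff_time m"
      using l m by (auto intro!: cutoff_time_mono)
    have carrier: "carrier (residue_ring (int p)) = {0..<int p}" by (auto simp: residue_ring_def)
    define T where "T = {n. tv m p n \<le> \<eta>}"
    have mix: "mix_time (residue_ring (int p)) (power2_set p) \<eta> = Inf T"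
      unfolding mix_time_def m(3) carrier T_def tv_def
      using m(4) by (simp add: conv_power_eq_map_int_walk)
    define N where "N = nat \<lceil>(1 + \<delta>) * cutoff_time m\<rceil>"
    have N: "N \<in> T" unfolding T_def mem_Collect_eq
      by (rule up[OF Mm p(1) m(5)]) (simp add: N_def real_nat_ceiling_ge)
    have "Inf T \<le> N" using N by (intro cInf_lower) auto
    moreover have "real N \<le> (1 + \<epsilon>) * cutoff_time l"
    proof -
      have "0 \<le> cutoff_time m" using c0_ge_2 l m by (auto simp: cutoff_time_def intro!: divide_nonneg_nonneg mult_nonneg_nonneg)
      hence "real N \<le> (1 + \<delta>) * cutoff_time m + 1" using \<delta> unfolding N_def by (simp add: of_nat_nat ceiling_le_iff)
      also have "\<dots> \<le> (1 + \<delta>) * cutoff_time l + 1" using cm \<delta> by simp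
      finally have "real N \<le> (1 + \<delta>) * cutoff_time l + 1" .
      moreover have "1 \<le> (\<epsilon> - \<delta>) * cutoff_time l" using l(3) \<delta> by (simp add: field_simps)
      ultimately show ?thesis by (simp add: algebra_simps)
    qed
    moreover have "(1 - \<epsilon>) * cutoff_time l \<le> real (Inf T)"
    proof (rule ccontr)
      assume "\<not> (1 - \<epsilon>) * cutoff_time l \<le> real (Inf T)"
      hence "real (Inf T) \<le> (1 - \<epsilon>) * cutoff_time l" by simp
      also have "\<dots> \<le> (1 - \<delta>) * cutoff_time (l - 1)" using l(2) c \<delta> by (simp add: field_simps)
      also have "\<dots> \<le> (1 - \<delta>) * cutoff_time m" using cm \<delta> by (intro mult_left_mono) auto
      finally have "\<eta> < tv m p (Inf T)" by (rule lo[OF Mm m(6)])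
      moreover have "Inf T \<in> T" using N by (intro Inf_nat_def1) auto
      ultimately show False by (simp add: T_def)
    qed
    ultimately show ?case unfolding mix l_def by simp
  qed
qed

lemma mix_time_ratio_tendsto:
  fixes \<eta> :: real
  assumes \<eta>: "0 < \<eta>" "\<eta> < 1"
  shows "((\<lambda>p. real (mix_time (residue_ring (int p)) (power2_set p) \<eta>) / cutoff_time (ell2 p)) \<longlongrightarrow> 1) primes_at_top"
proof (rule tendstoI)
  fix e :: real assume "0 < e"
  define \<epsilon> where "\<epsilon> = min (1/2) (e / 2)"
  have \<epsilon>: "0 < \<epsilon>" "\<epsilon> < 1" "\<epsilon> < e" using \<open>0 < e\<close> by (auto simp: \<epsilon>_def)
  have "\<forall>\<^sub>F l in at_top. 1 \<le> cutoff_time l" using filterlim_cutoff_time by (simp add: filterlim_at_top)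
  from filterlim_ell2[unfolded filterlim_iff, rule_format, OF this] mix_time_bounds[OF \<epsilon>(1,2) \<eta>]
  show "\<forall>\<^sub>F p in primes_at_top. dist (real (mix_time (residue_ring (int p)) (power2_set p) \<eta>) / cutoff_time (ell2 p)) 1 < e"
  proof eventually_elim
    case (elim p)
    define t where "t = real (mix_time (residue_ring (int p)) (power2_set p) \<eta>)"
    have "1 - \<epsilon> \<le> t / cutoff_time (ell2 p)" "t / cutoff_time (ell2 p) \<le> 1 + \<epsilon>"
      using elim by (simp_all add: t_def pos_le_divide_eq pos_divide_le_eq)
    thus ?case using \<epsilon> by (simp add: dist_real_def t_def[symmetric] abs_less_iff)
  qed
qed

theorem theorem6:
  shows "3.394649802 \<le> c0 \<and> c0 < 3.394649803 \<and>
    has_tv_cutoff (\<lambda>p. residue_ring (int p)) power2_set primes_at_top \<and>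
    asymp_equiv (\<lambda>p. real (mix_time (residue_ring (int p)) (power2_set p) (1 / exp 1)))
      primes_at_top
      (\<lambda>p. real (ell2 p) * ln (real (ell2 p)) / (2 * c0))"
proof -
  have "has_tv_cutoff (\<lambda>p. residue_ring (int p)) power2_set primes_at_top"
    unfolding has_tv_cutoff_def
  proof (intro allI impI)
    fix \<epsilon> :: real assume \<epsilon>: "0 < \<epsilon> \<and> \<epsilon> < 1 / 2"
    let ?t = "\<lambda>\<eta> p. real (mix_time (residue_ring (int p)) (power2_set p) \<eta>)"
    let ?q = "\<lambda>p. (?t \<epsilon> p / cutoff_time (ell2 p)) / (?t (1 - \<epsilon>) p / cutoff_time (ell2 p))"
    have "(?q \<longlongrightarrow> 1 / 1) primes_at_top"
      using \<epsilon> by (intro tendsto_divide mix_time_ratio_tendsto) auto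
    hence lim: "(?q \<longlongrightarrow> 1) primes_at_top" by (simp only: div_by_1)
    have "\<forall>\<^sub>F l in at_top. 1 \<le> cutoff_time l" using filterlim_cutoff_time by (simp add: filterlim_at_top)
    from filterlim_ell2[unfolded filterlim_iff, rule_format, OF this]
    have "\<forall>\<^sub>F p in primes_at_top. ?q p = ?t \<epsilon> p / ?t (1 - \<epsilon>) p"
      by eventually_elim auto
    with lim show "((\<lambda>p. ?t \<epsilon> p / ?t (1 - \<epsilon>) p) \<longlongrightarrow> 1) primes_at_top"
      by (rule Lim_transform_eventually)
  qed
  moreover have "asymp_equiv (\<lambda>p. real (mix_time (residue_ring (int p)) (power2_set p) (1 / exp 1)))
      primes_at_top (\<lambda>p. real (ell2 p) * ln (real (ell2 p)) / (2 * c0))"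
    using mix_time_ratio_tendsto[of "1 / exp 1"] unfolding cutoff_time_def by (intro asymp_equivI') simp
  ultimately show ?thesis using c0_numeric by blast
qed

end
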